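(* Let $n\ge1$, let $B$ be a finitely generated commutative associative unital algebra over $\mathbb{C}$, and let $V$ be an irreducible uniformly bounded module for $\mathfrak{L}(B)=(W_n\ltimes A_n)\otimes B$. If $t^{0}\otimes1$ acts as the identity on $V$, then $V$ is a single point evaluation module.
   Context: $A_n=\mathbb{C}[t_1^{\pm1},\dots,t_n^{\pm1}]$, $t^{m}=t_1^{m_1}\cdots t_n^{m_n}$ for $m\in\mathbb{Z}^n$ ($t^0$ is the unit of $A_n$), $d_i=t_i\frac{d}{dt_i}$, $W_n=\mathrm{Der}(A_n)$. For $u\in\mathbb{C}^n$, $r\in\mathbb{Z}^n$ put $D(u,r)=\sum_i u_i t^{r}d_i$; then $[D(u,r),D(v,s)]=D((u|s)v-(v|r)u,r+s)$, $(u|v)=\sum_i u_iv_i$. $\mathfrak{L}=W_n\ltimes A_n$, with $A_n$ an abelian ideal and $[D(u,r),t^{m}]=(u|m)t^{m+r}$. For a Lie algebra $\mathfrak{g}$, $\mathfrak{g}(B)=\mathfrak{g}\otimes B$ with $[x\otimes b,y\otimes b']=[x,y]\otimes bb'$. Weights are taken with respect to $H=\bigoplus_i\mathbb{C}d_i$ (acting as $H\otimes1$). A module is uniformly bounded if it is a direct sum of its weight spaces and there is $N\in\mathbb{N}$ with $\dim V_\lambda<N$ for all weights $\lambda$. A $\mathfrak{g}\otimes B$-module $V$ is a single point evaluation module if there is an algebra homomorphism $\eta:B\to\mathbb{C}$ with $(x\otimes b)v=\eta(b)(x\otimes1)v$ for all $x\in\mathfrak{g}$, $b\in B$, $v\in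 V$. *)

theory Defs
  imports "HOL-Analysis.Analysis" "HOL-Library.Poly_Mapping"
begin

section \<open>Complex vector spaces and algebras\<close>

class complex_vector = ab_group_add +
  fixes scaleC :: "complex \<Rightarrow> 'a \<Rightarrow> 'a"  (infixr \<open>*\<^sub>C\<close> 75)
  assumes scaleC_add_right: "a *\<^sub>C (x + y) = a *\<^sub>C x + a *\<^sub>C y"
    and scaleC_add_left: "(a + b) *\<^sub>C x = a *\<^sub>C x + b *\<^sub>C x"
    and scaleC_scaleC: "a *\<^sub>C b *\<^sub>C x = (a * b) *\<^sub>C x"
    and scaleC_one: "1 *\<^sub>C x = x"

global_interpretation complex_vector: vector_space
  "scaleC :: complex \<Rightarrow> 'a \<Rightarrow> 'a::complex_vector"
  defines csubspace = complex_vector.subspace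
    and cspan = complex_vector.span
    and cdim = complex_vector.dim
  by unfold_locales (simp_all add: scaleC_add_right scaleC_add_left scaleC_scaleC scaleC_one)

abbreviation clinear :: "('a::complex_vector \<Rightarrow> 'b::complex_vector) \<Rightarrow> bool"
  where "clinear \<equiv> Vector_Spaces.linear scaleC scaleC"

lemma clinearI:
  assumes "\<And>x y. f (x + y) = f x + f y" "\<And>a x. f (a *\<^sub>C x) = a *\<^sub>C f x"
  shows "clinear f"
  by unfold_locales (use assms in auto)

lemma clinear_rules:
  assumes "clinear f"
  shows "f (x + y) = f x + f y" "f (a *\<^sub>C x) = a *\<^sub>C f x" "f (x - y) = f x - f y"
    "f 0 = 0" "f (- x) = - f x" "f (sum g S) = (\<Sum>s\<in>S. f (g s))"
proof -
  interpret Vector_Spaces.linear scaleC scaleC f by fact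
  show "f (x + y) = f x + f y" "f (a *\<^sub>C x) = a *\<^sub>C f x" "f (x - y) = f x - f y"
    "f 0 = 0" "f (- x) = - f x" "f (sum g S) = (\<Sum>s\<in>S. f (g s))"
    by (simp_all add: add scale diff zero neg sum)
qed

definition cbilinear ::
    "('a::complex_vector \<Rightarrow> 'b::complex_vector \<Rightarrow> 'c::complex_vector) \<Rightarrow> bool"
  where "cbilinear \<phi> \<longleftrightarrow> (\<forall>x. clinear (\<phi> x)) \<and> (\<forall>y. clinear (\<lambda>x. \<phi> x y))"

lemma cbilinearD:
  assumes "cbilinear \<phi>" shows "clinear (\<phi> x)" "clinear (\<lambda>x. \<phi> x y)"
  using assms by (auto simp: cbilinear_def)

instantiation complex :: complex_vector
begin
definition scaleC_complex :: "complex \<Rightarrow> complex \<Rightarrow> complex"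
  where [simp]: "scaleC_complex a x = a * x"
instance by standard (auto simp: algebra_simps)
end

instantiation poly_mapping :: (type, complex_vector) complex_vector
begin
lift_definition scaleC_poly_mapping :: "complex \<Rightarrow> ('a \<Rightarrow>\<^sub>0 'b) \<Rightarrow> ('a \<Rightarrow>\<^sub>0 'b)"
  is "\<lambda>a f k. a *\<^sub>C f k"
  by (erule rev_finite_subset) auto
instance
  by standard
    (transfer, auto simp: fun_eq_iff scaleC_add_right scaleC_add_left scaleC_scaleC scaleC_one)+
end

lemma lookup_scaleC [simp]: "Poly_Mapping.lookup (a *\<^sub>C f) k = a *\<^sub>C Poly_Mapping.lookup f k"
  by (simp add: scaleC_poly_mapping.rep_eq)

lemma poly_mapping_expand:
  "f = (\<Sum>k\<in>Poly_Mapping.keys f. Poly_Mapping.single k (Poly_Mapping.lookup f k))"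
  by (rule poly_mapping_eqI)
    (auto simp: lookup_sum lookup_single when_def in_keys_iff if_distrib cong: if_cong)

text \<open>The unit of an algebra is allowed to be \<open>0\<close>, so that the zero algebra is included;
  this is why the class does not extend \<^class>\<open>comm_ring_1\<close>.\<close>

class complex_comm_algebra = complex_vector + comm_ring + comm_monoid_mult +
  assumes scaleC_mult_left: "(a *\<^sub>C x) * y = a *\<^sub>C (x * y)"
begin
lemma scaleC_mult_right: "x * (a *\<^sub>C y) = a *\<^sub>C (x * y)"
  using scaleC_mult_left[of a y x] by (simp add: mult.commute)
end

instance complex :: complex_comm_algebra
  by standard simp

definition subalgebra :: "'b::complex_comm_algebra set \<Rightarrow> bool"
  where "subalgebra S \<longleftrightarrow> csubspace S \<and> 1 \<in> S \<and> (\<forall>x\<in>S. \<forall>y\<in>S. x * y \<in> S)"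

definition finitely_generated_algebra :: "'b::complex_comm_algebra itself \<Rightarrow> bool"
  where "finitely_generated_algebra _ \<longleftrightarrow> (\<exists>S :: 'b set. finite S \<and> subalgebra hull S = UNIV)"

definition algebra_hom :: "('b::complex_comm_algebra \<Rightarrow> complex) \<Rightarrow> bool"
  where "algebra_hom \<eta> \<longleftrightarrow> clinear \<eta> \<and> \<eta> 1 = 1 \<and> (\<forall>b c. \<eta> (b * c) = \<eta> b * \<eta> c)"


section \<open>Lie algebras and modules\<close>

class lie_algebra = complex_vector +
  fixes lie_bracket :: "'a \<Rightarrow> 'a \<Rightarrow> 'a"
  assumes lie_add_left: "lie_bracket (x + y) z = lie_bracket x z + lie_bracket y z"
    and lie_add_right: "lie_bracket x (y + z) = lie_bracket x y + lie_bracket x z"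
    and lie_scaleC_left: "lie_bracket (a *\<^sub>C x) y = a *\<^sub>C lie_bracket x y"
    and lie_scaleC_right: "lie_bracket x (a *\<^sub>C y) = a *\<^sub>C lie_bracket x y"
    and lie_self: "lie_bracket x x = 0"
    and lie_jacobi: "lie_bracket x (lie_bracket y z) + lie_bracket y (lie_bracket z x)
      + lie_bracket z (lie_bracket x y) = 0"

lemma cbilinear_lie_bracket: "cbilinear (lie_bracket :: 'g::lie_algebra \<Rightarrow> _)"
  unfolding cbilinear_def
  by (auto intro!: clinearI simp: lie_add_left lie_add_right lie_scaleC_left lie_scaleC_right)

lemma lie_antisym: "lie_bracket y x = - lie_bracket x (y :: 'g::lie_algebra)"
proof -
  have "lie_bracket (x + y) (x + y) = lie_bracket x y + lie_bracket y x"
    by (simp only: lie_add_left lie_add_right) (simp add: lie_self)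
  then show ?thesis by (simp add: lie_self eq_neg_iff_add_eq_0 add.commute)
qed

definition lie_module :: "('g::lie_algebra \<Rightarrow> 'v::complex_vector \<Rightarrow> 'v) \<Rightarrow> bool"
  where "lie_module \<rho> \<longleftrightarrow> cbilinear \<rho> \<and>
    (\<forall>x y v. \<rho> (lie_bracket x y) v = \<rho> x (\<rho> y v) - \<rho> y (\<rho> x v))"

definition submodule :: "('g::lie_algebra \<Rightarrow> 'v::complex_vector \<Rightarrow> 'v) \<Rightarrow> 'v set \<Rightarrow> bool"
  where "submodule \<rho> U \<longleftrightarrow> csubspace U \<and> (\<forall>x. \<forall>u\<in>U. \<rho> x u \<in> U)"

definition irreducible_module :: "('g::lie_algebra \<Rightarrow> 'v::complex_vector \<Rightarrow> 'v) \<Rightarrow> bool"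
  where "irreducible_module \<rho> \<longleftrightarrow>
    (UNIV :: 'v set) \<noteq> {0} \<and> (\<forall>U. submodule \<rho> U \<longrightarrow> U = {0} \<or> U = UNIV)"


section \<open>Tensor products\<close>

text \<open>The tensor product over \<open>\<complex>\<close> is the free vector space on the set of pairs, modulo the span of
  the bilinearity relations.\<close>

inductive_set tensor_relations :: "('a::complex_vector \<times> 'b::complex_vector \<Rightarrow>\<^sub>0 complex) set"
  where
    rel_add_left: "Poly_Mapping.single (x + y, b) 1 - (Poly_Mapping.single (x, b) 1
      + Poly_Mapping.single (y, b) 1) \<in> tensor_relations"
  | rel_add_right: "Poly_Mapping.single (x, b + c) 1 - (Poly_Mapping.single (x, b) 1
      + Poly_Mapping.single (x, c) 1) \<in> tensor_relations"
  | rel_scaleC_left: "Poly_Mapping.single (a *\<^sub>C x, b) 1 - a *\<^sub>C Poly_Mapping.single (x, b) 1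
      \<in> tensor_relations"
  | rel_scaleC_right: "Poly_Mapping.single (x, a *\<^sub>C b) 1 - a *\<^sub>C Poly_Mapping.single (x, b) 1
      \<in> tensor_relations"

definition tensor_rel ::
    "('a::complex_vector \<times> 'b::complex_vector \<Rightarrow>\<^sub>0 complex) \<Rightarrow> ('a \<times> 'b \<Rightarrow>\<^sub>0 complex) \<Rightarrow> bool"
  where "tensor_rel F G \<longleftrightarrow> F - G \<in> cspan tensor_relations"

quotient_type (overloaded) ('a, 'b) tensor =
    "('a::complex_vector \<times> 'b::complex_vector) \<Rightarrow>\<^sub>0 complex" / tensor_rel
proof (rule equivpI)
  show "reflp tensor_rel"
    by (auto simp: reflp_def tensor_rel_def complex_vector.span_zero)
  show "symp tensor_rel"
    unfolding symp_def tensor_rel_def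
    by (auto dest: complex_vector.span_neg)
  show "transp tensor_rel"
    unfolding transp_def tensor_rel_def
    by (auto dest: complex_vector.span_add)
qed

instantiation tensor :: (complex_vector, complex_vector) complex_vector
begin
lift_definition zero_tensor :: "('a, 'b) tensor" is 0 .
lift_definition plus_tensor :: "('a, 'b) tensor \<Rightarrow> ('a, 'b) tensor \<Rightarrow> ('a, 'b) tensor" is "(+)"
  unfolding tensor_rel_def add_diff_add by (rule complex_vector.span_add)
lift_definition uminus_tensor :: "('a, 'b) tensor \<Rightarrow> ('a, 'b) tensor" is uminus
  unfolding tensor_rel_def minus_diff_minus by (rule complex_vector.span_neg)
lift_definition minus_tensor :: "('a, 'b) tensor \<Rightarrow> ('a, 'b) tensor \<Rightarrow> ('a, 'b) tensor" is "(-)"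
proof -
  fix F F' G G' :: "'a \<times> 'b \<Rightarrow>\<^sub>0 complex"
  assume "tensor_rel F F'" "tensor_rel G G'"
  then have "(F - F') - (G - G') \<in> cspan tensor_relations"
    unfolding tensor_rel_def by (rule complex_vector.span_diff)
  then show "tensor_rel (F - G) (F' - G')"
    by (simp add: tensor_rel_def algebra_simps)
qed
lift_definition scaleC_tensor :: "complex \<Rightarrow> ('a, 'b) tensor \<Rightarrow> ('a, 'b) tensor" is scaleC
  unfolding tensor_rel_def complex_vector.scale_right_diff_distrib[symmetric]
  by (rule complex_vector.span_scale)
instance
proof
  have refl: "tensor_rel F G" if "F = G" for F G :: "'a \<times> 'b \<Rightarrow>\<^sub>0 complex"
    using that by (simp add: tensor_rel_def complex_vector.span_zero)
  fix x y z :: "('a, 'b) tensor" and a b :: complex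
  show "x + y + z = x + (y + z)" by (transfer, rule refl) (rule add.assoc)
  show "x + y = y + x" by (transfer, rule refl) (rule add.commute)
  show "0 + x = x" by (transfer, rule refl) simp
  show "- x + x = 0" by (transfer, rule refl) simp
  show "x - y = x + - y" by (transfer, rule refl) simp
  show "a *\<^sub>C (x + y) = a *\<^sub>C x + a *\<^sub>C y" by (transfer, rule refl) (rule scaleC_add_right)
  show "(a + b) *\<^sub>C x = a *\<^sub>C x + b *\<^sub>C x" by (transfer, rule refl) (rule scaleC_add_left)
  show "a *\<^sub>C b *\<^sub>C x = (a * b) *\<^sub>C x" by (transfer, rule refl) (rule scaleC_scaleC)
  show "1 *\<^sub>C x = x" by (transfer, rule refl) (rule scaleC_one)
qed
end

lift_definition tens :: "'a::complex_vector \<Rightarrow> 'b::complex_vector \<Rightarrow> ('a, 'b) tensor"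
  is "\<lambda>x b. Poly_Mapping.single (x, b) 1" .

lemma tens_add_left: "tens (x + y) b = tens x b + tens y b"
  by (transfer, unfold tensor_rel_def, intro complex_vector.span_base tensor_relations.intros)

lemma tens_add_right: "tens x (b + c) = tens x b + tens x c"
  by (transfer, unfold tensor_rel_def, intro complex_vector.span_base tensor_relations.intros)

lemma tens_scaleC_left: "tens (a *\<^sub>C x) b = a *\<^sub>C tens x b"
  by (transfer, unfold tensor_rel_def, intro complex_vector.span_base tensor_relations.intros)

lemma tens_scaleC_right: "tens x (a *\<^sub>C b) = a *\<^sub>C tens x b"
  by (transfer, unfold tensor_rel_def, intro complex_vector.span_base tensor_relations.intros)

lemma cbilinear_tens: "cbilinear tens"
  unfolding cbilinear_def
  by (auto intro!: clinearI simp: tens_add_left tens_add_right tens_scaleC_left tens_scaleC_right)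

lemma tensor_induct [case_names zero tens add]:
  assumes "P 0" "\<And>x b. P (tens x b)" "\<And>z w. P z \<Longrightarrow> P w \<Longrightarrow> P (z + w)"
  shows "P z"
proof -
  have single: "abs_tensor (Poly_Mapping.single p c) = tens (c *\<^sub>C fst p) (snd p)" for p c
  proof -
    have "Poly_Mapping.single p c = c *\<^sub>C Poly_Mapping.single p 1"
      by (rule poly_mapping_eqI) (auto simp: lookup_single when_def)
    then have "abs_tensor (Poly_Mapping.single p c) = c *\<^sub>C tens (fst p) (snd p)"
      by (simp add: tens.abs_eq scaleC_tensor.abs_eq)
    then show ?thesis by (simp add: tens_scaleC_left)
  qed
  have "P (abs_tensor (\<Sum>p\<in>S. Poly_Mapping.single p (c p)))" if "finite S" for S c
    using that
  proof induction
    case empty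
    then show ?case using assms(1) by (simp flip: zero_tensor.abs_eq)
  next
    case (insert p S)
    then show ?case using assms(2,3) by (simp add: single flip: plus_tensor.abs_eq)
  qed
  from this[OF finite_keys] have "P (abs_tensor F)" for F
    by (subst poly_mapping_expand)
  then show ?thesis by (induction z) (simp add: tensor.abs_induct)
qed

text \<open>The linear map on the tensor product induced by a bilinear map \<open>\<phi>\<close>; it is unspecified
  for other \<open>\<phi>\<close>.\<close>

definition free_ext ::
    "('a::complex_vector \<Rightarrow> 'b::complex_vector \<Rightarrow> 'c::complex_vector) \<Rightarrow> ('a \<times> 'b \<Rightarrow>\<^sub>0 complex) \<Rightarrow> 'c"
  where "free_ext \<phi> F = (\<Sum>(x, b)\<in>Poly_Mapping.keys F. Poly_Mapping.lookup F (x, b) *\<^sub>C \<phi> x b)"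

definition tensor_lift ::
    "('a::complex_vector \<Rightarrow> 'b::complex_vector \<Rightarrow> 'c::complex_vector) \<Rightarrow> ('a, 'b) tensor \<Rightarrow> 'c"
  where "tensor_lift \<phi> z = free_ext \<phi> (rep_tensor z)"

lemma free_ext_superset:
  assumes "finite S" "Poly_Mapping.keys F \<subseteq> S"
  shows "free_ext \<phi> F = (\<Sum>(x, b)\<in>S. Poly_Mapping.lookup F (x, b) *\<^sub>C \<phi> x b)"
  unfolding free_ext_def
  by (rule sum.mono_neutral_left) (use assms in \<open>auto simp: in_keys_iff\<close>)

lemma clinear_free_ext: "clinear (free_ext \<phi>)"
proof (rule clinearI)
  fix F G :: "'a \<times> 'b \<Rightarrow>\<^sub>0 complex" and a
  let ?S = "Poly_Mapping.keys F \<union> Poly_Mapping.keys G"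
  have "Poly_Mapping.keys (F + G) \<subseteq> ?S" by (rule keys_add)
  then show "free_ext \<phi> (F + G) = free_ext \<phi> F + free_ext \<phi> G"
    by (subst (1 2 3) free_ext_superset[of ?S])
      (auto simp: lookup_add scaleC_add_left split_def simp flip: sum.distrib)
  have "Poly_Mapping.keys (a *\<^sub>C F) \<subseteq> Poly_Mapping.keys F" by (auto simp: in_keys_iff)
  then show "free_ext \<phi> (a *\<^sub>C F) = a *\<^sub>C free_ext \<phi> F"
    by (subst (1 2) free_ext_superset[of "Poly_Mapping.keys F"])
      (auto simp: complex_vector.scale_sum_right scaleC_scaleC split_def)
qed

lemma free_ext_single: "free_ext \<phi> (Poly_Mapping.single (x, b) 1) = \<phi> x b"
  by (subst free_ext_superset[of "{(x, b)}"]) (auto simp: scaleC_one)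

lemma free_ext_relations:
  assumes "cbilinear \<phi>" "F \<in> cspan tensor_relations"
  shows "free_ext \<phi> F = 0"
  using assms(2)
proof (induction rule: complex_vector.span_induct)
  case base
  show ?case
    unfolding complex_vector.subspace_def
    by (auto simp: clinear_rules[OF clinear_free_ext])
next
  case (step F)
  note l = clinear_rules[OF clinear_free_ext[of \<phi>]]
  from step show ?case
    by (auto elim!: tensor_relations.cases simp: l free_ext_single
        clinear_rules[OF cbilinearD(1)[OF assms(1)]] clinear_rules[OF cbilinearD(2)[OF assms(1)]])
qed

lemma free_ext_cong:
  assumes "cbilinear \<phi>" "tensor_rel F G"
  shows "free_ext \<phi> F = free_ext \<phi> G"
  using free_ext_relations[OF assms(1), of "F - G"] assms(2)
  by (simp add: tensor_rel_def clinear_rules[OF clinear_free_ext])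

lemma tensor_lift_abs:
  assumes "cbilinear \<phi>" shows "tensor_lift \<phi> (abs_tensor F) = free_ext \<phi> F"
  unfolding tensor_lift_def
  by (rule free_ext_cong[OF assms])
    (metis Quotient3_def Quotient3_tensor Quotient3_rep_abs equivp_reflp tensor_equivp)

lemma clinear_tensor_lift:
  assumes "cbilinear \<phi>" shows "clinear (tensor_lift \<phi>)"
proof (rule clinearI)
  show "tensor_lift \<phi> (z + w) = tensor_lift \<phi> z + tensor_lift \<phi> w" for z w
    by (induction z, induction w)
      (simp add: tensor_lift_abs[OF assms] plus_tensor.abs_eq clinear_rules[OF clinear_free_ext])
  show "tensor_lift \<phi> (a *\<^sub>C z) = a *\<^sub>C tensor_lift \<phi> z" for a z
    by (induction z)
      (simp add: tensor_lift_abs[OF assms] scaleC_tensor.abs_eq clinear_rules[OF clinear_free_ext])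
qed

lemma tensor_lift_tens:
  assumes "cbilinear \<phi>" shows "tensor_lift \<phi> (tens x b) = \<phi> x b"
  by (simp add: tens.abs_eq tensor_lift_abs[OF assms] free_ext_single)


section \<open>The current algebra of a Lie algebra\<close>

lemma tens_mult_bracket_bilinear:
  fixes x :: "'g::lie_algebra" and b :: "'b::complex_comm_algebra"
  shows "cbilinear (\<lambda>y c. tens (lie_bracket x y) (b * c))"
  unfolding cbilinear_def
  by (auto intro!: clinearI simp: lie_add_right lie_scaleC_right distrib_left scaleC_mult_right
      tens_add_left tens_add_right tens_scaleC_left tens_scaleC_right)

lemma clinear_ext:
  assumes "clinear f" "clinear g" "\<And>x b. f (tens x b) = g (tens x b)"
  shows "f z = g z"
  by (induction z rule: tensor_induct)
    (simp_all add: assms clinear_rules[OF assms(1)] clinear_rules[OF assms(2)])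

lemma clinear_plus: "clinear f \<Longrightarrow> clinear g \<Longrightarrow> clinear (\<lambda>x. f x + g x)"
  by (rule clinearI) (simp_all add: clinear_rules algebra_simps scaleC_add_right)

lemma clinear_scale: "clinear f \<Longrightarrow> clinear (\<lambda>x. a *\<^sub>C f x)"
  by (rule clinearI) (simp_all add: clinear_rules scaleC_add_right scaleC_scaleC mult.commute)

lemma tens_mult_bracket_lift_bilinear:
  "cbilinear (\<lambda>(x::'g::lie_algebra) (b::'b::complex_comm_algebra).
     tensor_lift (\<lambda>y c. tens (lie_bracket x y) (b * c)) w)"
proof -
  note B = tens_mult_bracket_bilinear
  note l = clinear_tensor_lift[OF B]
  note simps = lie_add_left lie_scaleC_left distrib_right scaleC_mult_left
      tens_add_left tens_add_right tens_scaleC_left tens_scaleC_right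
  show ?thesis
    unfolding cbilinear_def
    by (safe; rule clinearI; rule clinear_ext[of _ _ w]; (intro l clinear_plus clinear_scale)?;
        simp only: tensor_lift_tens[OF B]; simp add: simps)
qed

text \<open>The bracket on \<open>\<gg> \<otimes> B\<close> is the bilinear extension of
  \<open>[x \<otimes> b, y \<otimes> c] = [x, y] \<otimes> b c\<close>.\<close>

instantiation tensor :: (lie_algebra, complex_comm_algebra) lie_algebra
begin

definition lie_bracket_tensor :: "('a, 'b) tensor \<Rightarrow> ('a, 'b) tensor \<Rightarrow> ('a, 'b) tensor"
  where "lie_bracket_tensor z w =
    tensor_lift (\<lambda>x b. tensor_lift (\<lambda>y c. tens (lie_bracket x y) (b * c)) w) z"

lemma lie_bracket_tens_left:
  "lie_bracket (tens x b) w = tensor_lift (\<lambda>y c. tens (lie_bracket x y) (b * c)) w"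
  for x :: 'a and b :: 'b
  unfolding lie_bracket_tensor_def by (rule tensor_lift_tens[OF tens_mult_bracket_lift_bilinear])

lemma lie_bracket_tens:
  "lie_bracket (tens x b) (tens y c) = tens (lie_bracket x y) (b * c)" for x :: 'a and b :: 'b
  unfolding lie_bracket_tens_left by (rule tensor_lift_tens[OF tens_mult_bracket_bilinear])

instance
proof
  note B1 = tens_mult_bracket_lift_bilinear and B2 = tens_mult_bracket_bilinear
  fix x y z :: "('a, 'b) tensor" and a :: complex
  show add_left: "lie_bracket (x + y) z = lie_bracket x z + lie_bracket y z"
    for x y z :: "('a, 'b) tensor"
    by (simp add: lie_bracket_tensor_def clinear_rules[OF clinear_tensor_lift[OF B1]])
  show scale_left: "lie_bracket (a *\<^sub>C x) y = a *\<^sub>C lie_bracket x y"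
    for a and x y :: "('a, 'b) tensor"
    by (simp add: lie_bracket_tensor_def clinear_rules[OF clinear_tensor_lift[OF B1]])
  have lin: "clinear (\<lambda>w. lie_bracket w z)" for z :: "('a, 'b) tensor"
    by (rule clinearI) (simp_all add: add_left scale_left)
  show add_right: "lie_bracket x (y + z) = lie_bracket x y + lie_bracket x z"
    for x y z :: "('a, 'b) tensor"
    by (rule clinear_ext[of _ _ x]; (intro lin clinear_plus)?)
      (simp only: lie_bracket_tens_left clinear_rules[OF clinear_tensor_lift[OF B2]])
  show scale_right: "lie_bracket x (a *\<^sub>C y) = a *\<^sub>C lie_bracket x y"
    for a and x y :: "('a, 'b) tensor"
    by (rule clinear_ext[of _ _ x]; (intro lin clinear_scale)?)
      (simp only: lie_bracket_tens_left clinear_rules[OF clinear_tensor_lift[OF B2]])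
  have lin': "clinear (lie_bracket z)" for z :: "('a, 'b) tensor"
    by (rule clinearI) (simp_all add: add_right scale_right)
  have zero: "lie_bracket 0 z = 0" "lie_bracket z 0 = 0" for z :: "('a, 'b) tensor"
    using clinear_rules(4)[OF lin] clinear_rules(4)[OF lin'] by auto
  have neg_tens: "tens (- u) b = - tens u b" for u :: 'a and b :: 'b
    using clinear_rules(5)[OF cbilinearD(2)[OF cbilinear_tens]] .
  have anti: "lie_bracket x y + lie_bracket y x = 0" for x y :: "('a, 'b) tensor"
  proof (induction x rule: tensor_induct)
    case (tens u b)
    show ?case
    proof (induction y rule: tensor_induct)
      case (tens v c)
      show ?case
        by (simp add: lie_bracket_tens lie_antisym[of v u] neg_tens mult.commute)
    next
      case (add z w)
      then show ?case by (simp add: add_left add_right algebra_simps)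
    qed (simp add: zero)
  next
    case (add z w)
    then show ?case by (simp add: add_left add_right algebra_simps)
  qed (simp add: zero)
  show "lie_bracket x x = 0"
  proof -
    have "2 *\<^sub>C lie_bracket x x = lie_bracket x x + lie_bracket x x"
      by (metis one_add_one scaleC_add_left scaleC_one)
    then show ?thesis using anti[of x x] by (simp add: complex_vector.scale_eq_0_iff)
  qed
  let ?J = "\<lambda>x y z :: ('a, 'b) tensor. lie_bracket x (lie_bracket y z)
      + lie_bracket y (lie_bracket z x) + lie_bracket z (lie_bracket x y)"
  have J: "?J (x + x') y z = ?J x y z + ?J x' y z" "?J x (y + y') z = ?J x y z + ?J x y' z"
    "?J x y (z + z') = ?J x y z + ?J x y z'" for x x' y y' z z'
    by (simp_all add: add_left add_right algebra_simps)
  show "?J x y z = 0"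
  proof (induction x rule: tensor_induct)
    case (tens u b)
    show ?case
    proof (induction y rule: tensor_induct)
      case (tens v c)
      show ?case
      proof (induction z rule: tensor_induct)
        case (tens w d)
        have "b * (c * d) = c * (d * b)" "d * (b * c) = c * (d * b)"
          by (simp_all add: ac_simps)
        then show ?case
          by (simp add: lie_bracket_tens lie_jacobi flip: tens_add_left)
            (metis cbilinearD(2) cbilinear_tens clinear_rules(4))
      next
        case (add z w)
        then show ?case by (simp only: J) simp
      qed (simp add: zero)
    next
      case (add z w)
      then show ?case by (simp only: J) simp
    qed (simp add: zero)
  next
    case (add z w)
    then show ?case by (simp only: J) simp
  qed (simp add: zero)
qed

end

definition single_point_evaluation ::
    "(('g::lie_algebra, 'b::complex_comm_algebra) tensor \<Rightarrow> 'v::complex_vector \<Rightarrow> 'v) \<Rightarrow> bool"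
  where "single_point_evaluation \<rho> \<longleftrightarrow>
    (\<exists>\<eta>. algebra_hom \<eta> \<and> (\<forall>x b v. \<rho> (tens x b) v = \<eta> b *\<^sub>C \<rho> (tens x 1) v))"


section \<open>Laurent polynomials and the Witt algebra\<close>

text \<open>\<open>A\<^sub>n\<close> is the group algebra of \<open>\<int>\<^sup>n\<close>: the monomial \<open>t\<^sup>m\<close> is
  \<open>Poly_Mapping.single m 1\<close>, and \<open>n\<close> is the cardinality of the index type.\<close>

type_synonym 'n laurent = "(int ^ 'n) \<Rightarrow>\<^sub>0 complex"

definition derivation :: "('n::finite laurent \<Rightarrow> 'n laurent) \<Rightarrow> bool"
  where "derivation D \<longleftrightarrow> clinear D \<and> (\<forall>f g. D (f * g) = D f * g + f * D g)"

lemma laurent_scaleC_eq: "a *\<^sub>C f = Poly_Mapping.single 0 a * f" for f :: "'n::finite laurent"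
proof -
  have "Poly_Mapping.single 0 a * f =
      (\<Sum>k\<in>Poly_Mapping.keys f. Poly_Mapping.single k (a * Poly_Mapping.lookup f k))"
    by (subst (1) poly_mapping_expand[of f]) (simp add: sum_distrib_left mult_single)
  also have "\<dots> = a *\<^sub>C f"
    by (rule poly_mapping_eqI)
      (auto simp: lookup_sum lookup_single when_def in_keys_iff if_distrib cong: if_cong)
  finally show ?thesis by simp
qed

lemma laurent_scaleC_mult:
  fixes f g :: "'n::finite laurent"
  shows "(a *\<^sub>C f) * g = a *\<^sub>C (f * g)" "f * (a *\<^sub>C g) = a *\<^sub>C (f * g)"
  by (simp_all add: laurent_scaleC_eq ac_simps)

text \<open>\<open>W\<^sub>n = Der(A\<^sub>n)\<close>.\<close>

typedef (overloaded) 'n witt = "{D :: 'n::finite laurent \<Rightarrow> 'n laurent. derivation D}"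
  morphisms apply_witt Abs_witt
  by (rule exI[of _ "\<lambda>_. 0"]) (auto simp: derivation_def intro!: clinearI)

setup_lifting type_definition_witt

lemma derivation_apply_witt: "derivation (apply_witt D)"
  using apply_witt by blast

lemmas apply_witt_rules = clinear_rules[OF derivation_apply_witt[unfolded derivation_def, THEN conjunct1]]

lemma apply_witt_mult: "apply_witt D (f * g) = apply_witt D f * g + f * apply_witt D g"
  using derivation_apply_witt[of D] by (simp add: derivation_def)

lemma witt_eqI: "(\<And>f. apply_witt D f = apply_witt E f) \<Longrightarrow> D = E"
  by (simp add: apply_witt_inject[symmetric] fun_eq_iff)

instantiation witt :: (finite) lie_algebra
begin
lift_definition zero_witt :: "'a witt" is "\<lambda>_. 0"
  by (auto simp: derivation_def intro!: clinearI)
lift_definition plus_witt :: "'a witt \<Rightarrow> 'a witt \<Rightarrow> 'a witt" is "\<lambda>D E f. D f + E f"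
  by (auto simp: derivation_def clinear_rules algebra_simps scaleC_add_right intro!: clinearI)
lift_definition uminus_witt :: "'a witt \<Rightarrow> 'a witt" is "\<lambda>D f. - D f"
  by (auto simp: derivation_def clinear_rules algebra_simps intro!: clinearI)
lift_definition minus_witt :: "'a witt \<Rightarrow> 'a witt \<Rightarrow> 'a witt" is "\<lambda>D E f. D f - E f"
  by (auto simp: derivation_def clinear_rules algebra_simps
      complex_vector.scale_right_diff_distrib intro!: clinearI)
lift_definition scaleC_witt :: "complex \<Rightarrow> 'a witt \<Rightarrow> 'a witt" is "\<lambda>a D f. a *\<^sub>C D f"
  by (auto simp: derivation_def clinear_rules scaleC_add_right laurent_scaleC_mult
      mult.commute scaleC_scaleC intro!: clinearI)
lift_definition lie_bracket_witt :: "'a witt \<Rightarrow> 'a witt \<Rightarrow> 'a witt"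
  is "\<lambda>D E f. D (E f) - E (D f)"
  by (auto simp: derivation_def clinear_rules algebra_simps
      complex_vector.scale_right_diff_distrib intro!: clinearI)
instance
  by standard
    (rule witt_eqI, simp add: plus_witt.rep_eq zero_witt.rep_eq uminus_witt.rep_eq
      minus_witt.rep_eq scaleC_witt.rep_eq lie_bracket_witt.rep_eq apply_witt_rules algebra_simps
      scaleC_add_right scaleC_add_left scaleC_scaleC scaleC_one
      complex_vector.scale_right_diff_distrib)+
end

text \<open>\<open>d\<^sub>i = t\<^sub>i \<partial>/\<partial>t\<^sub>i\<close> multiplies the coefficient of \<open>t\<^sup>m\<close> by \<open>m\<^sub>i\<close>.\<close>

lemma derivation_degree:
  fixes i :: "'n::finite"
  shows "derivation (Poly_Mapping.mapp (\<lambda>m c. of_int (m $ i) * c) :: 'n laurent \<Rightarrow> 'n laurent)"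
proof -
  define d :: "'n laurent \<Rightarrow> 'n laurent"
    where "d = Poly_Mapping.mapp (\<lambda>m c. of_int (m $ i) * c)"
  have lookup: "Poly_Mapping.lookup (d f) m = of_int (m $ i) * Poly_Mapping.lookup f m" for f m
    by (auto simp: d_def lookup_mapp when_def in_keys_iff)
  have lin: "clinear d"
    by (rule clinearI; rule poly_mapping_eqI)
      (simp_all add: lookup lookup_add algebra_simps)
  have single: "d (Poly_Mapping.single m c) = Poly_Mapping.single m (of_int (m $ i) * c)" for m c
    by (rule poly_mapping_eqI) (auto simp: lookup lookup_single when_def)
  have leib1: "d (Poly_Mapping.single m c * g) = d (Poly_Mapping.single m c) * g
      + Poly_Mapping.single m c * d g" for m c g
    by (subst (1 2 3) poly_mapping_expand[of g])
      (simp add: sum_distrib_left clinear_rules[OF lin] mult_single single algebra_simps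
        flip: sum.distrib single_add)
  have "d (f * g) = d f * g + f * d g" for f g
    by (subst (1 2 3) poly_mapping_expand[of f])
      (simp only: sum_distrib_right clinear_rules[OF lin] leib1 sum.distrib)
  with lin show ?thesis by (auto simp: derivation_def d_def)
qed

lift_definition degree_derivation :: "'n::finite \<Rightarrow> 'n witt"
  is "\<lambda>i. Poly_Mapping.mapp (\<lambda>m c. of_int (m $ i) * c)"
  by (rule derivation_degree)

text \<open>\<open>\<LL> = W\<^sub>n \<ltimes> A\<^sub>n\<close>; \<open>SD D f\<close> stands for \<open>D + f\<close>.\<close>

datatype 'n witt_laurent = SD (der_part: "'n::finite witt") (fun_part: "'n laurent")

instantiation witt_laurent :: (finite) lie_algebra
begin
definition "0 = SD 0 0"
definition "x + y = SD (der_part x + der_part y) (fun_part x + fun_part y)"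
definition "- x = SD (- der_part x) (- fun_part x)"
definition "x - y = SD (der_part x - der_part y) (fun_part x - fun_part y)"
definition "a *\<^sub>C x = SD (a *\<^sub>C der_part x) (a *\<^sub>C fun_part x)"
definition "lie_bracket x y = SD (lie_bracket (der_part x) (der_part y))
  (apply_witt (der_part x) (fun_part y) - apply_witt (der_part y) (fun_part x))"
instance
proof
  fix x y z :: "'a witt_laurent"
  show "lie_bracket x (lie_bracket y z) + lie_bracket y (lie_bracket z x)
      + lie_bracket z (lie_bracket x y) = 0"
    by (simp add: zero_witt_laurent_def plus_witt_laurent_def lie_bracket_witt_laurent_def
        lie_jacobi lie_bracket_witt.rep_eq apply_witt_rules)
qed (simp_all add: zero_witt_laurent_def plus_witt_laurent_def uminus_witt_laurent_def
    minus_witt_laurent_def scaleC_witt_laurent_def lie_bracket_witt_laurent_def algebra_simps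
    scaleC_add_right scaleC_add_left scaleC_scaleC scaleC_one
    lie_add_left lie_add_right lie_scaleC_left lie_scaleC_right lie_self
    apply_witt_rules plus_witt.rep_eq scaleC_witt.rep_eq
    complex_vector.scale_right_diff_distrib)
end


section \<open>Weights and uniformly bounded modules\<close>

text \<open>A weight \<open>\<mu> \<in> H\<^sup>*\<close> is recorded by its values \<open>\<mu> $ i\<close> on the basis vectors \<open>d\<^sub>i\<close> of \<open>H\<close>.\<close>

definition weight_space ::
    "(('n::finite witt_laurent, 'b::complex_comm_algebra) tensor \<Rightarrow> 'v::complex_vector \<Rightarrow> 'v)
      \<Rightarrow> complex ^ 'n \<Rightarrow> 'v set"
  where "weight_space \<rho> \<mu> =
    {v. \<forall>i. \<rho> (tens (SD (degree_derivation i) 0) 1) v = (\<mu> $ i) *\<^sub>C v}"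

definition direct_sum_of :: "('i \<Rightarrow> 'v::complex_vector set) \<Rightarrow> bool"
  where "direct_sum_of U \<longleftrightarrow>
    (\<forall>v. \<exists>!f :: 'i \<Rightarrow>\<^sub>0 'v. (\<forall>i. Poly_Mapping.lookup f i \<in> U i) \<and>
       v = (\<Sum>i\<in>Poly_Mapping.keys f. Poly_Mapping.lookup f i))"

text \<open>\<^const>\<open>cdim\<close> is \<open>0\<close> on infinite-dimensional spaces, so finite dimension is required
  separately.\<close>

definition finite_dimensional :: "'v::complex_vector set \<Rightarrow> bool"
  where "finite_dimensional U \<longleftrightarrow> (\<exists>S. finite S \<and> U \<subseteq> cspan S)"

definition uniformly_bounded ::
    "(('n::finite witt_laurent, 'b::complex_comm_algebra) tensor \<Rightarrow> 'v::complex_vector \<Rightarrow> 'v) \<Rightarrow> bool"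
  where "uniformly_bounded \<rho> \<longleftrightarrow> direct_sum_of (weight_space \<rho>) \<and>
    (\<exists>N. \<forall>\<mu>. weight_space \<rho> \<mu> \<noteq> {0} \<longrightarrow>
       finite_dimensional (weight_space \<rho> \<mu>) \<and> cdim (weight_space \<rho> \<mu>) < N)"

end

theory Submission
  imports Defs "HOL-Computational_Algebra.Fundamental_Theorem_Algebra"
begin

text \<open>
  Write \<open>T m b\<close> and \<open>D u r b\<close> for the operators by which \<open>t\<^sup>m \<otimes> b\<close> and \<open>D(u,r) \<otimes> b\<close> act
  on the module, and \<open>T m\<close> for \<open>T m 1\<close>. These operators span the action, because every
  derivation of the Laurent polynomials is a finite sum of monomial ones
  (\<open>witt_sum_of_monomials\<close>). The whole argument takes place in the algebra of linear
  endomorphisms of the module and only uses the commutation relations between these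
  operators, irreducibility, and the bound on the weight spaces.

  \<^bold>\<open>Commuting operators are scalar up to degree.\<close> The \<open>T m b\<close> commute, and their
  commutators with the \<open>D u r b\<close> are again multiples of such operators. Consider a
  commutative algebra of operators that contains them and is stable under commutators
  with all \<open>D u r b\<close>. For \<open>x\<close> in it, the commutator \<open>[D u r b, x]\<close> commutes with \<open>x\<close>, so
  the generalised kernel of \<open>x\<close> is a submodule: \<open>x\<close> is injective or locally nilpotent.
  If \<open>x\<close> moreover preserves weights, local nilpotency and the bound on the dimensions
  give \<open>x ^ N = 0\<close> for one \<open>N\<close>, and nilpotency, unlike local nilpotency, is inherited by
  \<open>[D u r b, x]\<close> (\<open>nilpotent_commutator\<close>). If \<open>T m\<close> were not injective, taking
  commutators would lead from the nilpotent operator \<open>T m * T (- m)\<close> down to the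
  nilpotency of \<open>T 0 = 1\<close>. With all \<open>T m\<close> injective, take a common eigenvector of the
  weight-preserving operators in one weight space; the vectors on which they act by the
  same scalars form a submodule, so each of them is a scalar (\<open>degree_zero_scalar\<close>).
  Consequently every operator of degree \<open>m\<close> in the algebra is a multiple of \<open>T m\<close>.

  \<^bold>\<open>The abelian part.\<close> In particular \<open>T m b = a(m,b) T m\<close>. Comparing the commutators of
  \<open>D u r c\<close> with both sides shows that \<open>a(m,b)\<close> does not depend on \<open>m\<close> and is
  multiplicative in \<open>b\<close>: it is an algebra homomorphism \<open>\<eta>\<close> (\<open>T_evaluation\<close>).

  \<^bold>\<open>The derivation part.\<close> It remains to see that \<open>D u r c = 0\<close> whenever \<open>\<eta> c = 0\<close>. For
  such \<open>c\<close> the operator \<open>D u r c\<close> commutes with all \<open>T m b\<close>, hence is determined by its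
  restriction to one weight space. So the set \<open>K\<close> of all \<open>c\<close> in the kernel of \<open>\<eta>\<close> with
  every \<open>D u r c = 0\<close> has finite codimension in that kernel, and it is an ideal. If the
  two were different, multiplication by \<open>B\<close> would have a common eigenvector \<open>c\<close> in the
  quotient; in particular \<open>c * c\<close> would be congruent to a multiple of \<open>c\<close>. If the
  multiple is \<open>0\<close>, the \<open>D u r c\<close> commute with each other, and joining them to the
  \<open>T m b\<close> gives another commutative algebra to which the scalar argument applies; this
  forces \<open>D u r c = 0\<close>. If the multiple is not \<open>0\<close>, then the \<open>D u r c\<close>, brought back to
  degree \<open>0\<close> by the \<open>T (- r)\<close>, act on one finite-dimensional weight space like a
  multiple of a representation of the Witt algebra; there an element of large degree
  shifts the eigenvalues of the degree operator out of its spectrum, so it acts by zero,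
  and again all \<open>D u r c\<close> vanish. Either way \<open>c\<close> lies in \<open>K\<close>, which is a contradiction.
\<close>

section \<open>Linear algebra modulo a subspace\<close>

text \<open>More vectors than \<open>card S\<close> are dependent in the quotient by \<open>K\<close>. Statements about quotients are
  phrased modulo \<open>K\<close> throughout, without forming cosets: the case \<open>K = {0}\<close> will be applied to weight
  spaces, and another one to ideals of \<open>B\<close>.\<close>
lemma dependent_modulo_span:
  fixes g :: "'i \<Rightarrow> 'a::complex_vector"
  assumes "finite S" "finite I" "card S < card I" "csubspace K"
    and "\<And>i. i \<in> I \<Longrightarrow> g i \<in> cspan (S \<union> K)"
  shows "\<exists>a. (\<exists>i\<in>I. a i \<noteq> 0) \<and> (\<Sum>i\<in>I. a i *\<^sub>C g i) \<in> K"
  using assms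
proof (induction S arbitrary: I g rule: finite_induct)
  case empty
  then obtain j where j: "j \<in> I" by fastforce
  have "cspan K = K" using empty(3) by (rule complex_vector.span_eq_iff[THEN iffD2])
  then have "g j \<in> K" using empty(4)[OF j] \<open>cspan K = K\<close> by simp
  moreover have "(\<Sum>i\<in>I. (if i = j then 1 else 0) *\<^sub>C g i) = g j"
    using empty j by (simp add: if_distrib[of "\<lambda>a. a *\<^sub>C _"] scaleC_one cong: if_cong)
  ultimately show ?case using j by (intro exI[of _ "\<lambda>i. if i = j then 1 else 0"]) auto
next
  case (insert s S)
  have "\<exists>k. g i - k *\<^sub>C s \<in> cspan (S \<union> K)" if "i \<in> I" for i
    using insert.prems(4)[OF that] by (simp add: complex_vector.span_breakdown_eq)
  then obtain \<alpha> where \<alpha>: "\<And>i. i \<in> I \<Longrightarrow> g i - \<alpha> i *\<^sub>C s \<in> cspan (S \<union> K)" by metis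
  show ?case
  proof (cases "\<forall>i\<in>I. \<alpha> i = 0")
    case True
    then show ?thesis using insert.IH[of I g] insert.prems \<alpha> insert.hyps by auto
  next
    case False
    then obtain j where j: "j \<in> I" "\<alpha> j \<noteq> 0" by blast
    define h where "h i = g i - (\<alpha> i / \<alpha> j) *\<^sub>C g j" for i
    have "h i \<in> cspan (S \<union> K)" if "i \<in> I - {j}" for i
    proof -
      have "h i = (g i - \<alpha> i *\<^sub>C s) - (\<alpha> i / \<alpha> j) *\<^sub>C (g j - \<alpha> j *\<^sub>C s)"
        using j(2) by (simp add: h_def complex_vector.scale_right_diff_distrib scaleC_scaleC)
      also have "\<dots> \<in> cspan (S \<union> K)"
        using \<alpha>[of i] \<alpha>[OF j(1)] that
        by (metis DiffD1 complex_vector.span_diff complex_vector.span_scale)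
      finally show ?thesis .
    qed
    moreover have "card S < card (I - {j})" using insert j by simp
    ultimately obtain a where a: "\<exists>i\<in>I - {j}. a i \<noteq> 0" "(\<Sum>i\<in>I - {j}. a i *\<^sub>C h i) \<in> K"
      using insert.IH[of "I - {j}" h] insert.prems by auto
    \<comment> \<open>The coefficient at \<open>j\<close> collects the multiples of \<open>g j\<close> hidden in the \<open>h i\<close>.\<close>
    define b where "b = a(j := - (\<Sum>i\<in>I - {j}. a i * (\<alpha> i / \<alpha> j)))"
    have "(\<Sum>i\<in>I. b i *\<^sub>C g i) = b j *\<^sub>C g j + (\<Sum>i\<in>I - {j}. b i *\<^sub>C g i)"
      using insert.prems j by (simp add: sum.remove)
    also have "(\<Sum>i\<in>I - {j}. b i *\<^sub>C g i) = (\<Sum>i\<in>I - {j}. a i *\<^sub>C g i)"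
      by (rule sum.cong) (auto simp: b_def)
    also have "b j *\<^sub>C g j + \<dots> = (\<Sum>i\<in>I - {j}. a i *\<^sub>C h i)"
      by (simp add: b_def h_def complex_vector.scale_right_diff_distrib scaleC_scaleC
          sum_subtractf complex_vector.scale_sum_left)
    finally have "(\<Sum>i\<in>I. b i *\<^sub>C g i) \<in> K" using a(2) by simp
    moreover have "\<exists>i\<in>I. b i \<noteq> 0" using a(1) by (auto simp: b_def)
    ultimately show ?thesis by blast
  qed
qed

text \<open>The vector \<open>p(f) c\<close>, computed by Horner's rule.\<close>
definition poly_apply :: "('a::complex_vector \<Rightarrow> 'a) \<Rightarrow> 'a \<Rightarrow> complex poly \<Rightarrow> 'a"
  where "poly_apply f c p = fold_coeffs (\<lambda>a x. a *\<^sub>C c + f x) p 0"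

lemma poly_apply_0 [simp]: "poly_apply f c 0 = 0"
  by (simp add: poly_apply_def)

lemma poly_apply_pCons:
  assumes "clinear f"
  shows "poly_apply f c (pCons a p) = a *\<^sub>C c + f (poly_apply f c p)"
  by (cases "p = 0 \<and> a = 0") (auto simp: poly_apply_def clinear_rules[OF assms])

lemma poly_apply_add:
  assumes "clinear f"
  shows "poly_apply f c (p + q) = poly_apply f c p + poly_apply f c q"
proof (induction p q rule: poly_induct2)
  case (pCons a p b q)
  then show ?case
    by (simp add: poly_apply_pCons[OF assms] clinear_rules[OF assms] scaleC_add_left)
qed simp

lemma poly_apply_smult:
  assumes "clinear f"
  shows "poly_apply f c (smult a p) = a *\<^sub>C poly_apply f c p"
  by (induction p)
    (simp_all add: poly_apply_pCons[OF assms] clinear_rules[OF assms] scaleC_add_right scaleC_scaleC)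

lemma poly_apply_monom:
  assumes "clinear f"
  shows "poly_apply f c (monom a i) = a *\<^sub>C (f ^^ i) c"
  by (induction i)
    (simp_all add: monom_0 monom_Suc poly_apply_pCons[OF assms] clinear_rules[OF assms])

lemma poly_apply_linear_factor:
  assumes "clinear f"
  shows "poly_apply f c ([:- z, 1:] * q) = f (poly_apply f c q) - z *\<^sub>C poly_apply f c q"
proof -
  have "[:- z, 1:] * q = pCons 0 q + smult (- z) q" by simp
  then show ?thesis
    by (simp only: poly_apply_add[OF assms] poly_apply_smult[OF assms] poly_apply_pCons[OF assms])
      simp
qed

lemma poly_apply_closed:
  assumes "clinear f" "csubspace M" "\<And>x. x \<in> M \<Longrightarrow> f x \<in> M" "c \<in> M"
  shows "poly_apply f c p \<in> M"
  by (induction p)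
    (use assms in \<open>auto simp: poly_apply_pCons complex_vector.subspace_0
      intro!: complex_vector.subspace_add complex_vector.subspace_scale\<close>)

text \<open>Splitting off linear factors of \<open>p\<close> one by one, some factor \<open>f - z\<close> must be the one that
  moves a vector from outside \<open>K\<close> into \<open>K\<close>.\<close>
lemma eigenvector_modulo_of_annihilating_poly:
  assumes "clinear f" "csubspace K" "csubspace M" "\<And>x. x \<in> M \<Longrightarrow> f x \<in> M"
    and "c \<in> M - K" "p \<noteq> 0" "poly_apply f c p \<in> K"
  shows "\<exists>z. \<exists>x\<in>M - K. f x - z *\<^sub>C x \<in> K"
  using assms(6,7)
proof (induction "degree p" arbitrary: p)
  case 0
  then obtain a where "p = [:a:]" "a \<noteq> 0"
    by (metis degree_eq_zeroE pCons_0_0)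
  then have "a *\<^sub>C c \<in> K" using 0 by (simp add: poly_apply_pCons[OF assms(1)] clinear_rules[OF assms(1)])
  then have "(1 / a) *\<^sub>C a *\<^sub>C c \<in> K" by (rule complex_vector.subspace_scale[OF assms(2)])
  then show ?case using \<open>a \<noteq> 0\<close> assms(5) by (simp add: scaleC_scaleC scaleC_one)
next
  case (Suc n)
  then have "\<not> constant (poly p)" by (simp add: constant_degree)
  then obtain z where "poly p z = 0" using fundamental_theorem_of_algebra by blast
  then obtain q where q: "p = [:- z, 1:] * q" by (metis dvdE poly_eq_0_iff_dvd)
  let ?x = "poly_apply f c q"
  have "f ?x - z *\<^sub>C ?x \<in> K" using Suc.prems(2) unfolding q poly_apply_linear_factor[OF assms(1)] .
  moreover have "?x \<in> M" using assms by (intro poly_apply_closed) auto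
  moreover have "degree q = n" "q \<noteq> 0"
  proof -
    show "q \<noteq> 0" using Suc.prems q by auto
    then have "degree p = Suc (degree q)" unfolding q by (subst degree_mult_eq) auto
    then show "degree q = n" using Suc by simp
  qed
  ultimately show ?case using Suc.hyps(1)[of q] by (cases "?x \<in> K") auto
qed

lemma eigenvector_modulo:
  fixes f :: "'a::complex_vector \<Rightarrow> 'a"
  assumes "clinear f" "csubspace K" "csubspace M" "\<And>x. x \<in> M \<Longrightarrow> f x \<in> M"
    and "finite S" "M \<subseteq> cspan (S \<union> K)" "c \<in> M - K"
  shows "\<exists>z. \<exists>x\<in>M - K. f x - z *\<^sub>C x \<in> K"
proof -
  have iter: "(f ^^ i) c \<in> M" for i
    by (induction i) (use assms in auto)
  then have "\<And>i. (f ^^ i) c \<in> cspan (S \<union> K)" using assms by blast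
  then obtain a where a: "\<exists>i\<le>card S. a i \<noteq> 0" "(\<Sum>i\<le>card S. a i *\<^sub>C (f ^^ i) c) \<in> K"
    using dependent_modulo_span[of S "{..card S}" K "\<lambda>i. (f ^^ i) c"] assms by auto
  define p where "p = (\<Sum>i\<le>card S. monom (a i) i)"
  have "coeff p i = a i" if "i \<le> card S" for i
    using that by (simp add: p_def coeff_sum)
  then have "p \<noteq> 0" using a(1) by auto
  moreover have "poly_apply f c p = (\<Sum>i\<le>card S. a i *\<^sub>C (f ^^ i) c)"
  proof -
    have "poly_apply f c (\<Sum>i\<in>I. monom (a i) i) = (\<Sum>i\<in>I. a i *\<^sub>C (f ^^ i) c)" if "finite I" for I
      using that
      by induction (simp_all add: poly_apply_add[OF assms(1)] poly_apply_monom[OF assms(1)])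
    then show ?thesis by (simp add: p_def)
  qed
  ultimately show ?thesis
    using eigenvector_modulo_of_annihilating_poly[OF assms(1-4,7)] a(2) by metis
qed

text \<open>Rank and nullity modulo \<open>K\<close>, as an induction step: a vector outside \<open>K\<close> that \<open>g\<close> maps into \<open>K\<close>
  can be exchanged into the spanning set, and is then lost in the image.\<close>
lemma image_smaller_of_kernel:
  fixes g :: "'a::complex_vector \<Rightarrow> 'a"
  assumes "clinear g" "csubspace K" "\<And>x. x \<in> K \<Longrightarrow> g x \<in> K"
    and "finite S" "M \<subseteq> cspan (S \<union> K)" "x \<in> M - K" "g x \<in> K"
  shows "\<exists>S'. finite S' \<and> card S' < card S \<and> g ` M \<subseteq> cspan (S' \<union> K)"
proof -
  have "\<exists>s\<in>S'. s \<in> cspan (insert x (S' - {s} \<union> K))" if "finite S'" "x \<in> cspan (S' \<union> K)" for S'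
    using that
  proof (induction S' rule: finite_induct)
    case empty
    then show ?case using assms by (simp add: complex_vector.span_eq_iff[THEN iffD2])
  next
    case (insert s S')
    show ?case
    proof (cases "x \<in> cspan (S' \<union> K)")
      case True
      then obtain t where "t \<in> S'" "t \<in> cspan (insert x (S' - {t} \<union> K))" using insert.IH by blast
      moreover have "cspan (insert x (S' - {t} \<union> K)) \<subseteq> cspan (insert x (insert s S' - {t} \<union> K))"
        by (rule complex_vector.span_mono) auto
      ultimately show ?thesis by blast
    next
      case False
      have "x \<in> cspan (insert s (S' \<union> K))" using insert.prems by simp
      then have "s \<in> cspan (insert x (S' \<union> K))"
        using False by (rule complex_vector.in_span_insert)
      moreover have "insert s S' - {s} = S'" using insert.hyps by auto
      ultimately show ?thesis by force
    qed
  qed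
  then obtain s where s: "s \<in> S" "s \<in> cspan (insert x (S - {s} \<union> K))"
    using assms by blast
  let ?S = "g ` (S - {s})"
  have "M \<subseteq> cspan (insert x (S - {s} \<union> K))"
  proof -
    have "S \<union> K \<subseteq> cspan (insert x (S - {s} \<union> K))"
      using s(2) complex_vector.span_superset[of "insert x (S - {s} \<union> K)"] by blast
    then have "cspan (S \<union> K) \<subseteq> cspan (insert x (S - {s} \<union> K))"
      by (rule complex_vector.span_minimal) (rule complex_vector.subspace_span)
    then show ?thesis using assms(5) by blast
  qed
  moreover have "g y \<in> cspan (?S \<union> K)" if "y \<in> cspan (insert x (S - {s} \<union> K))" for y
    using that
  proof (induction rule: complex_vector.span_induct)
    case base
    show ?case
      by (auto simp: complex_vector.subspace_def clinear_rules[OF assms(1)]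
          complex_vector.span_zero complex_vector.span_add complex_vector.span_scale)
  next
    case (step y)
    then have "g y \<in> ?S \<union> K" using assms(3,7) by auto
    then show ?case by (rule complex_vector.span_base)
  qed
  moreover have "card ?S < card S"
    using assms(4) s(1) by (metis card_Diff1_less card_image_le finite_Diff le_less_trans)
  ultimately show ?thesis using assms(4) by (intro exI[of _ ?S]) auto
qed

lemma clinear_shift: "clinear f \<Longrightarrow> clinear (\<lambda>x. f x - z *\<^sub>C x)"
  by (rule clinearI) (simp_all add: clinear_rules scaleC_add_right scaleC_scaleC mult.commute
      complex_vector.scale_right_diff_distrib)

lemma csubspace_image:
  assumes "clinear f" "csubspace M"
  shows "csubspace (f ` M)"
proof -
  have "f 0 = 0" "f x + f y = f (x + y)" "a *\<^sub>C f x = f (a *\<^sub>C x)" for x y a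
    using assms(1) by (simp_all add: clinear_rules)
  moreover have "0 \<in> f ` M"
    using calculation(1) complex_vector.subspace_0[OF assms(2)] by (metis imageI)
  ultimately show ?thesis
    using assms(2) by (auto simp: complex_vector.subspace_def)
qed

text \<open>If every \<open>f\<close> is scalar modulo \<open>K\<close>, any vector will do. Otherwise some \<open>f - z\<close> has a nontrivial
  kernel modulo \<open>K\<close> and is not zero modulo \<open>K\<close>. Its image plus \<open>K\<close> is again stable under the
  commuting family, is not \<open>K\<close>, and needs fewer generators.\<close>
theorem common_eigenvector_modulo:
  fixes F :: "('a::complex_vector \<Rightarrow> 'a) set"
  assumes F: "\<And>f. f \<in> F \<Longrightarrow> clinear f" "\<And>f g x. f \<in> F \<Longrightarrow> g \<in> F \<Longrightarrow> x \<in> M \<Longrightarrow> f (g x) = g (f x)"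
    and K: "csubspace K" "\<And>f x. f \<in> F \<Longrightarrow> x \<in> K \<Longrightarrow> f x \<in> K"
    and "csubspace M" "\<And>f x. f \<in> F \<Longrightarrow> x \<in> M \<Longrightarrow> f x \<in> M" "K \<subseteq> M" "K \<noteq> M"
    and "finite S" "M \<subseteq> cspan (S \<union> K)"
  shows "\<exists>x\<in>M - K. \<forall>f\<in>F. \<exists>z. f x - z *\<^sub>C x \<in> K"
  using assms(2,5-)
proof (induction "card S" arbitrary: S M rule: less_induct)
  case less
  obtain c where c: "c \<in> M - K" using less.prems by blast
  show ?case
  proof (cases "\<forall>f\<in>F. \<exists>z. \<forall>x\<in>M. f x - z *\<^sub>C x \<in> K")
    case True
    then show ?thesis using c by blast
  next
    case False
    then obtain f where f: "f \<in> F" "\<And>z. \<exists>x\<in>M. f x - z *\<^sub>C x \<notin> K" by blast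
    obtain z x where x: "x \<in> M - K" "f x - z *\<^sub>C x \<in> K"
      using eigenvector_modulo[OF F(1)[OF f(1)] K(1) less.prems(2) less.prems(3)[OF f(1)]
          less.prems(6,7) c] by blast
    define g where "g x = f x - z *\<^sub>C x" for x
    have lin: "clinear g" unfolding g_def using F(1)[OF f(1)] by (rule clinear_shift)
    have gK: "g y \<in> K" if "y \<in> K" for y
      using that K f(1) by (auto simp: g_def intro!: complex_vector.subspace_diff complex_vector.subspace_scale)
    have gM: "g y \<in> M" if "y \<in> M" for y
      using that less.prems f(1) by (auto simp: g_def intro!: complex_vector.subspace_diff complex_vector.subspace_scale)
    obtain S' where S': "finite S'" "card S' < card S" "g ` M \<subseteq> cspan (S' \<union> K)"
      using image_smaller_of_kernel[OF lin K(1) gK less.prems(6,7) x(1)] x(2) by (auto simp: g_def)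
    define M' where "M' = {y + k |y k. y \<in> g ` M \<and> k \<in> K}"
    have "csubspace (g ` M)"
      using lin less.prems(2) by (rule csubspace_image)
    then have sub: "csubspace M'" unfolding M'_def using K(1) by (rule complex_vector.subspace_sums)
    have "\<exists>x\<in>M' - K. \<forall>f\<in>F. \<exists>z. f x - z *\<^sub>C x \<in> K"
    proof (rule less.hyps[OF S'(2)])
      have M': "M' \<subseteq> M"
        using gM less.prems by (auto simp: M'_def intro!: complex_vector.subspace_add)
      then show "h (h' y) = h' (h y)" if "h \<in> F" "h' \<in> F" "y \<in> M'" for h h' y
        using that less.prems(1) by blast
      show "csubspace M'" by (rule sub)
      show "h y \<in> M'" if "h \<in> F" "y \<in> M'" for h y
      proof -
        obtain w k where y: "y = g w + k" "w \<in> M" "k \<in> K" using \<open>y \<in> M'\<close> by (auto simp: M'_def)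
        have "h y = g (h w) + h k"
          using less.prems(1)[OF \<open>h \<in> F\<close> f(1) y(2)]
          by (simp add: y g_def clinear_rules[OF F(1)[OF \<open>h \<in> F\<close>]])
        moreover have "g (h w) \<in> g ` M" "h k \<in> K" using that y K(2) less.prems(3) by auto
        ultimately show ?thesis unfolding M'_def by blast
      qed
      show "K \<subseteq> M'"
      proof
        fix k assume "k \<in> K"
        moreover have "0 \<in> g ` M"
          using \<open>csubspace (g ` M)\<close> by (rule complex_vector.subspace_0)
        moreover have "k = 0 + k" by simp
        ultimately show "k \<in> M'" unfolding M'_def by blast
      qed
      obtain w where w: "w \<in> M" "g w \<notin> K" using f(2)[of z] by (auto simp: g_def)
      have "g w = g w + 0" by simp
      then have "g w \<in> M'"
        unfolding M'_def using w(1) complex_vector.subspace_0[OF K(1)] by blast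
      then show "K \<noteq> M'" using w(2) by blast
      show "finite S'" by (rule S'(1))
      show "M' \<subseteq> cspan (S' \<union> K)"
        using S'(3) by (auto simp: M'_def intro!: complex_vector.span_add intro: complex_vector.span_base)
    qed
    moreover have "M' \<subseteq> M"
      using gM less.prems by (auto simp: M'_def intro!: complex_vector.subspace_add)
    ultimately show ?thesis by blast
  qed
qed

text \<open>A substitute for the characteristic polynomial: the list \<open>zs\<close> contains every eigenvalue of \<open>f\<close>
  on \<open>M\<close>.\<close>
lemma product_of_shifts_vanishes:
  fixes f :: "'a::complex_vector \<Rightarrow> 'a"
  assumes "clinear f" "csubspace M" "\<And>x. x \<in> M \<Longrightarrow> f x \<in> M" "finite S" "M \<subseteq> cspan S"
  shows "\<exists>zs. \<forall>x\<in>M. fold (\<lambda>z x. f x - z *\<^sub>C x) zs x = 0"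
  using assms(2-)
proof (induction "card S" arbitrary: S M rule: less_induct)
  case less
  show ?case
  proof (cases "M = {0}")
    case True
    then show ?thesis by (intro exI[of _ "[]"]) simp
  next
    case False
    then obtain c where c: "c \<in> M - {0}" using complex_vector.subspace_0[OF less.prems(1)] by blast
    have K: "csubspace {0::'a}" by simp
    have SK: "M \<subseteq> cspan (S \<union> {0})" using less.prems(4) by simp
    obtain z x where x: "x \<in> M - {0}" "f x - z *\<^sub>C x \<in> {0}"
      using eigenvector_modulo[OF assms(1) K less.prems(1,2,3) SK c] by blast
    define g where "g x = f x - z *\<^sub>C x" for x
    have lin: "clinear g" unfolding g_def using assms(1) by (rule clinear_shift)
    obtain S' where S': "finite S'" "card S' < card S" "g ` M \<subseteq> cspan (S' \<union> {0})"
      using image_smaller_of_kernel[OF lin K _ less.prems(3) SK x(1)] x(2)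
      by (auto simp: g_def clinear_rules[OF assms(1)])
    have "csubspace (g ` M)"
      using lin less.prems(1) by (rule csubspace_image)
    moreover have "f (g y) = g (f y)" for y by (simp add: g_def clinear_rules[OF assms(1)])
    then have "f y \<in> g ` M" if "y \<in> g ` M" for y using that less.prems(2) by auto
    ultimately obtain zs where "\<forall>x\<in>g ` M. fold (\<lambda>z x. f x - z *\<^sub>C x) zs x = 0"
      using less.hyps[OF S'(2), of "g ` M"] S' by auto
    then show ?thesis by (intro exI[of _ "z # zs"]) (simp add: g_def)
  qed
qed

text \<open>A vector annihilated by two coprime polynomials in \<open>f\<close>, both split into linear factors, is
  zero.\<close>
lemma disjoint_shifts_eq_zero:
  fixes f :: "'a::complex_vector \<Rightarrow> 'a"
  assumes "clinear f" "fold (\<lambda>z x. f x - z *\<^sub>C x) zs w = 0"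
    "fold (\<lambda>z x. f x - z *\<^sub>C x) ys w = 0" "set zs \<inter> set ys = {}"
  shows "w = 0"
  using assms(2-)
proof (induction zs arbitrary: w)
  case (Cons a zs)
  note f = clinear_rules[OF assms(1)]
  have comm: "fold (\<lambda>z x. f x - z *\<^sub>C x) ys (f w - a *\<^sub>C w)
      = f (fold (\<lambda>z x. f x - z *\<^sub>C x) ys w) - a *\<^sub>C fold (\<lambda>z x. f x - z *\<^sub>C x) ys w" for ys w
  proof (induction ys arbitrary: w)
    case (Cons b ys)
    have "f (f w - a *\<^sub>C w) - b *\<^sub>C (f w - a *\<^sub>C w) = f (f w - b *\<^sub>C w) - a *\<^sub>C (f w - b *\<^sub>C w)"
      by (simp add: f complex_vector.scale_right_diff_distrib scaleC_scaleC algebra_simps)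
    then show ?case using Cons.IH[of "f w - b *\<^sub>C w"] by simp
  qed simp
  have "f w - a *\<^sub>C w = 0"
  proof (rule Cons.IH)
    show "fold (\<lambda>z x. f x - z *\<^sub>C x) zs (f w - a *\<^sub>C w) = 0" using Cons.prems(1) by simp
    show "fold (\<lambda>z x. f x - z *\<^sub>C x) ys (f w - a *\<^sub>C w) = 0"
      unfolding comm Cons.prems(2) by (simp add: f)
    show "set zs \<inter> set ys = {}" using Cons.prems(3) by auto
  qed
  then have fw: "f w = a *\<^sub>C w" by simp
  have "a \<notin> set ys" using Cons.prems by auto
  then show ?case
    using Cons.prems(2) fw
  proof (induction ys arbitrary: w)
    case (Cons b ys)
    have fb: "f w - b *\<^sub>C w = (a - b) *\<^sub>C w"
      unfolding Cons.prems(3) by (simp only: complex_vector.scale_left_diff_distrib)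
    have "(a - b) *\<^sub>C w = 0"
    proof (rule Cons.IH)
      show "a \<notin> set ys" using Cons.prems(1) by simp
      show "fold (\<lambda>z x. f x - z *\<^sub>C x) ys ((a - b) *\<^sub>C w) = 0"
        using Cons.prems(2) fb by simp
      show "f ((a - b) *\<^sub>C w) = a *\<^sub>C (a - b) *\<^sub>C w"
        unfolding f(2) Cons.prems(3) by (simp only: scaleC_scaleC mult.commute)
    qed
    then show ?case using Cons.prems(1) by (auto simp: complex_vector.scale_eq_0_iff)
  qed simp
qed simp

text \<open>\<open>M\<close> is spanned by the kernel together with preimages of a basis of the image.\<close>
lemma finite_codimension_kernel:
  fixes \<phi> :: "'a::complex_vector \<Rightarrow> 'c::complex_vector"
  assumes "clinear \<phi>" "csubspace M" "finite T" "\<phi> ` M \<subseteq> cspan T"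
  shows "\<exists>S. finite S \<and> M \<subseteq> cspan (S \<union> {x \<in> M. \<phi> x = 0})"
proof -
  note \<phi> = clinear_rules[OF assms(1)]
  obtain B where B: "B \<subseteq> \<phi> ` M" "complex_vector.independent B" "\<phi> ` M \<subseteq> cspan B"
    by (rule complex_vector.maximal_independent_subset)
  have "finite B"
    using complex_vector.independent_span_bound[OF assms(3) B(2)] B(1) assms(4) by blast
  have "\<forall>b\<in>B. \<exists>x\<in>M. \<phi> x = b" using B(1) by blast
  then obtain s where s: "\<And>b. b \<in> B \<Longrightarrow> s b \<in> M" "\<And>b. b \<in> B \<Longrightarrow> \<phi> (s b) = b" by metis
  have lift: "\<exists>w\<in>cspan (s ` B). \<phi> w = y" if "y \<in> cspan B" for y
    using that
  proof (induction rule: complex_vector.span_induct)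
    case base
    show ?case
    proof (rule complex_vector.subspaceI)
      show "0 \<in> {y. \<exists>w\<in>cspan (s ` B). \<phi> w = y}"
        using complex_vector.span_zero \<phi>(4) by blast
    qed (auto simp flip: \<phi> intro: complex_vector.span_add complex_vector.span_scale)
  next
    case (step y)
    then show ?case using s(2) by (auto intro: complex_vector.span_base)
  qed
  have "x \<in> cspan (s ` B \<union> {x \<in> M. \<phi> x = 0})" if x: "x \<in> M" for x
  proof -
    obtain w where w: "w \<in> cspan (s ` B)" "\<phi> w = \<phi> x" using lift x B(3) by blast
    have "cspan (s ` B) \<subseteq> M" using s(1) assms(2) by (intro complex_vector.span_minimal) auto
    then have "x - w \<in> {x \<in> M. \<phi> x = 0}"
      using x w assms(2) by (auto simp: \<phi> intro: complex_vector.subspace_diff)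
    then have "w + (x - w) \<in> cspan (s ` B \<union> {x \<in> M. \<phi> x = 0})"
      using w(1) complex_vector.span_mono[of "s ` B" "s ` B \<union> {x \<in> M. \<phi> x = 0}"]
      by (intro complex_vector.span_add) (auto intro: complex_vector.span_base)
    then show ?thesis by simp
  qed
  then show ?thesis using \<open>finite B\<close> by (intro exI[of _ "s ` B"]) auto
qed

lemma finite_codimension_common_kernel:
  fixes \<phi> :: "'i \<Rightarrow> 'a::complex_vector \<Rightarrow> 'c::complex_vector"
  assumes "finite X" "\<And>i. clinear (\<phi> i)" "csubspace M" "\<And>i. i \<in> X \<Longrightarrow> \<phi> i ` M \<subseteq> cspan T" "finite T"
  shows "\<exists>S. finite S \<and> M \<subseteq> cspan (S \<union> {x \<in> M. \<forall>i\<in>X. \<phi> i x = 0})"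
  using assms(1,4)
proof (induction X rule: finite_induct)
  case empty
  show ?case by (intro exI[of _ "{}"]) (auto intro: complex_vector.span_base)
next
  case (insert j X)
  let ?M = "{x \<in> M. \<forall>i\<in>X. \<phi> i x = 0}" and ?N = "{x \<in> M. \<forall>i\<in>insert j X. \<phi> i x = 0}"
  obtain S where S: "finite S" "M \<subseteq> cspan (S \<union> ?M)" using insert by auto
  have "csubspace ?M"
    using assms(3) by (auto simp: complex_vector.subspace_def clinear_rules[OF assms(2)])
  moreover have "\<phi> j ` ?M \<subseteq> cspan T" using insert.prems by auto
  ultimately have "\<exists>S'. finite S' \<and> ?M \<subseteq> cspan (S' \<union> {x \<in> ?M. \<phi> j x = 0})"
    using finite_codimension_kernel[OF assms(2) _ assms(5)] by blast
  then obtain S' where S': "finite S'" "?M \<subseteq> cspan (S' \<union> {x \<in> ?M. \<phi> j x = 0})" by blast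
  have eq: "{x \<in> ?M. \<phi> j x = 0} = ?N" by auto
  have "S \<union> ?M \<subseteq> cspan (S \<union> S' \<union> ?N)"
    using S'(2) complex_vector.span_mono[of "S' \<union> ?N" "S \<union> S' \<union> ?N"]
    unfolding eq by (auto intro: complex_vector.span_base)
  then have "cspan (S \<union> ?M) \<subseteq> cspan (S \<union> S' \<union> ?N)"
    by (rule complex_vector.span_minimal) (rule complex_vector.subspace_span)
  then show ?case using S S'(1) by (intro exI[of _ "S \<union> S'"]) auto
qed

section \<open>Endomorphisms and nilpotent commutators\<close>

text \<open>The linear endomorphisms get a type of their own, so that products of operators can be handled
  by the ring laws. On the zero space the identity is zero, which is why the ring is not
  declared to be in \<^class>\<open>ring_1\<close>.\<close>
typedef (overloaded) 'v endo = "{f :: 'v::complex_vector \<Rightarrow> 'v. clinear f}"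
  morphisms endo_apply Abs_endo
  by (rule exI[of _ "\<lambda>_. 0"]) (auto intro!: clinearI)

notation endo_apply (infixr \<open>\<triangleright>\<close> 75)

setup_lifting type_definition_endo

lemma clinear_endo_apply: "clinear (endo_apply f)"
  using endo_apply by blast

lemmas endo_rules = clinear_rules[OF clinear_endo_apply]

lemma endo_eqI: "(\<And>v. f \<triangleright> v = g \<triangleright> v) \<Longrightarrow> f = g"
  by (simp add: endo_apply_inject[symmetric] fun_eq_iff)

instantiation endo :: (complex_vector) complex_vector
begin
lift_definition zero_endo :: "'a endo" is "\<lambda>_. 0"
  by (auto intro!: clinearI)
lift_definition plus_endo :: "'a endo \<Rightarrow> 'a endo \<Rightarrow> 'a endo" is "\<lambda>f g v. f v + g v"
  by (rule clinearI) (simp_all add: clinear_rules algebra_simps scaleC_add_right)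
lift_definition uminus_endo :: "'a endo \<Rightarrow> 'a endo" is "\<lambda>f v. - f v"
  by (rule clinearI) (simp_all add: clinear_rules)
lift_definition minus_endo :: "'a endo \<Rightarrow> 'a endo \<Rightarrow> 'a endo" is "\<lambda>f g v. f v - g v"
  by (rule clinearI)
    (simp_all add: clinear_rules algebra_simps complex_vector.scale_right_diff_distrib)
lift_definition scaleC_endo :: "complex \<Rightarrow> 'a endo \<Rightarrow> 'a endo" is "\<lambda>a f v. a *\<^sub>C f v"
  by (rule clinearI) (simp_all add: clinear_rules scaleC_add_right scaleC_scaleC mult.commute)
instance
  by standard
    (rule endo_eqI, simp add: plus_endo.rep_eq zero_endo.rep_eq uminus_endo.rep_eq minus_endo.rep_eq
      scaleC_endo.rep_eq scaleC_add_right scaleC_add_left scaleC_scaleC scaleC_one)+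
end

instantiation endo :: (complex_vector) "{ring, monoid_mult}"
begin
lift_definition one_endo :: "'a endo" is "\<lambda>v. v"
  by (rule clinearI) simp_all
lift_definition times_endo :: "'a endo \<Rightarrow> 'a endo \<Rightarrow> 'a endo" is "\<lambda>f g v. f (g v)"
  by (rule clinearI) (simp_all add: clinear_rules)
instance
  by standard
    (rule endo_eqI, simp add: plus_endo.rep_eq one_endo.rep_eq times_endo.rep_eq endo_rules)+
end

lemmas endo_apply_simps = plus_endo.rep_eq zero_endo.rep_eq uminus_endo.rep_eq minus_endo.rep_eq
  scaleC_endo.rep_eq one_endo.rep_eq times_endo.rep_eq

lemma endo_scaleC_mult:
  fixes f g :: "'v::complex_vector endo"
  shows "(a *\<^sub>C f) * g = a *\<^sub>C (f * g)" "f * (a *\<^sub>C g) = a *\<^sub>C (f * g)"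
  by (rule endo_eqI, simp add: endo_apply_simps endo_rules)+

definition nilpotent :: "'v::complex_vector endo \<Rightarrow> bool"
  where "nilpotent x \<longleftrightarrow> (\<exists>k. x ^ k = 0)"

lemma nilpotent_mult:
  assumes "nilpotent x" "x * y = y * x"
  shows "nilpotent (y * x)"
proof -
  obtain k where "x ^ k = 0" using assms by (auto simp: nilpotent_def)
  moreover have "(y * x) ^ n = y ^ n * x ^ n" for n
  proof (induction n)
    case (Suc n)
    have "(y * x) ^ Suc n = y * (x * y ^ n) * x ^ n" using Suc by (simp add: mult.assoc)
    also have "x * y ^ n = y ^ n * x"
      using power_commuting_commutes[of y x n] assms(2) by simp
    finally show ?case by (simp add: mult.assoc)
  qed simp
  ultimately have "(y * x) ^ k = 0" by simp
  then show ?thesis by (auto simp: nilpotent_def)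
qed

lemma nilpotent_add:
  assumes "nilpotent x" "nilpotent y" "x * y = y * x"
  shows "nilpotent (x + y)"
proof -
  obtain a b where ab: "x ^ a = 0" "y ^ b = 0" using assms by (auto simp: nilpotent_def)
  have zero: "z ^ i = 0" if "z ^ j = 0" "j \<le> i" for z :: "'a endo" and i j
    using that by (metis le_add_diff_inverse mult_zero_left power_add)
  have "(x + y) ^ n * (x ^ i * y ^ j) = 0" if "a + b \<le> n + i + j" for n i j
    using that
  proof (induction n arbitrary: i j)
    case 0
    then have "a \<le> i \<or> b \<le> j" by linarith
    then show ?case using zero ab by auto
  next
    case (Suc n)
    have "y * x ^ i = x ^ i * y" using assms(3) by (metis power_commuting_commutes)
    then have "(x + y) * (x ^ i * y ^ j) = x ^ Suc i * y ^ j + x ^ i * y ^ Suc j"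
      by (simp add: distrib_right) (simp add: mult.assoc[symmetric])
    moreover have "(x + y) ^ Suc n * w = (x + y) ^ n * ((x + y) * w)" for w
      by (simp only: power_Suc2 mult.assoc)
    ultimately have "(x + y) ^ Suc n * (x ^ i * y ^ j)
        = (x + y) ^ n * (x ^ Suc i * y ^ j) + (x + y) ^ n * (x ^ i * y ^ Suc j)"
      by (simp only: distrib_left)
    also have "\<dots> = 0" using Suc.IH[of "Suc i" j] Suc.IH[of i "Suc j"] Suc.prems by simp
    finally show ?case .
  qed
  from this[of "a + b" 0 0] show ?thesis by (auto simp: nilpotent_def)
qed

lemma nilpotent_root: "nilpotent (x * x) \<Longrightarrow> nilpotent x"
  unfolding nilpotent_def by (metis power2_eq_square power_mult)

lemma commutator_power:
  fixes x y d :: "'v::complex_vector endo"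
  assumes "d * x - x * d = y" "x * y = y * x"
  shows "d * x ^ Suc n - x ^ Suc n * d = of_nat (Suc n) *\<^sub>C (x ^ n * y)"
proof (induction n)
  case 0
  then show ?case using assms by (simp add: scaleC_one)
next
  case (Suc n)
  have "d * x ^ Suc (Suc n) - x ^ Suc (Suc n) * d
      = (d * x ^ Suc n - x ^ Suc n * d) * x + x ^ Suc n * (d * x - x * d)"
    unfolding power_Suc2[of x "Suc n"] by (simp add: algebra_simps)
  also have "\<dots> = of_nat (Suc n) *\<^sub>C (x ^ Suc n * y) + x ^ Suc n * y"
    unfolding Suc assms(1)
    by (simp only: endo_scaleC_mult mult.assoc assms(2)[symmetric] power_Suc2)
  also have "\<dots> = of_nat (Suc (Suc n)) *\<^sub>C (x ^ Suc n * y)"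
    by (simp only: of_nat_Suc[of "Suc n"] scaleC_add_left scaleC_one add.commute)
  finally show ?case .
qed

lemma commutator_power_mult:
  fixes x y d :: "'v::complex_vector endo"
  assumes "d * x - x * d = y" "x * y = y * x"
  shows "(d * x ^ n - x ^ n * d) * x = of_nat n *\<^sub>C (x ^ n * y)"
proof (cases n)
  case 0
  then show ?thesis by simp
next
  case (Suc m)
  have "(d * x ^ n - x ^ n * d) * x = of_nat n *\<^sub>C (x ^ m * y * x)"
    unfolding Suc commutator_power[OF assms] by (simp only: endo_scaleC_mult)
  also have "x ^ m * y * x = x ^ n * y"
    using assms(2) unfolding Suc power_Suc2 by (simp only: mult.assoc)
  finally show ?thesis .
qed

text \<open>In a commutative algebra over a field of characteristic \<open>0\<close>, a derivation maps nilpotent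
  elements to nilpotent elements; here the derivation is the commutator with \<open>d\<close>. Differentiating
  \<open>x ^ (i + 1) * y ^ (2 * j) = 0\<close> and multiplying by \<open>y\<close> trades one factor \<open>x\<close> for two factors \<open>y\<close>.\<close>
lemma nilpotent_commutator:
  fixes x y z d :: "'v::complex_vector endo"
  assumes xy: "d * x - x * d = y" "x * y = y * x"
    and yz: "d * y - y * d = z" "y * z = z * y"
    and "nilpotent x"
  shows "nilpotent y"
proof -
  obtain k where k: "x ^ k = 0" using assms(5) by (auto simp: nilpotent_def)
  have "j \<le> k \<Longrightarrow> x ^ (k - j) * y ^ (2 * j) = 0" for j
  proof (induction j)
    case 0
    then show ?case using k by simp
  next
    case (Suc j)
    define i where "i = k - Suc j"
    have i: "k - j = Suc i" using Suc.prems by (simp add: i_def)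
    let ?p = "x ^ Suc i" and ?q = "y ^ (2 * j)"
    have 0: "?p * ?q = 0" using Suc i by simp
    have "0 = (d * (?p * ?q) - (?p * ?q) * d) * y" by (simp only: 0) simp
    also have "\<dots> = (d * ?p - ?p * d) * ?q * y + ?p * ((d * ?q - ?q * d) * y)"
      by (simp add: algebra_simps)
    also have "\<dots> = of_nat (Suc i) *\<^sub>C (x ^ i * y * ?q * y) + of_nat (2 * j) *\<^sub>C (?p * ?q * z)"
      unfolding commutator_power[OF xy] commutator_power_mult[OF yz]
      by (simp only: endo_scaleC_mult mult.assoc)
    also have "\<dots> = of_nat (Suc i) *\<^sub>C (x ^ i * (y * ?q * y))" by (simp only: 0 mult.assoc) simp
    also have "y * ?q * y = y ^ (2 * Suc j)"
      by (simp add: power_commutes mult.assoc)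
    finally have "of_nat (Suc i) *\<^sub>C (x ^ i * y ^ (2 * Suc j)) = 0" by (rule sym)
    then have "x ^ i * y ^ (2 * Suc j) = 0"
      using of_nat_neq_0[of i] by (simp only: complex_vector.scale_eq_0_iff) blast
    then show ?case by (simp add: i_def)
  qed
  from this[of k] show ?thesis by (auto simp: nilpotent_def)
qed

section \<open>Commutants\<close>

text \<open>The bicommutant of a commuting set plays the part of the commutative algebra generated by it: it
  is commutative, closed under the operations, and stable under the same inner derivations, and
  all of this follows without an induction over generated elements.\<close>
definition commutant :: "'v::complex_vector endo set \<Rightarrow> 'v endo set"
  where "commutant G = {x. \<forall>g\<in>G. x * g = g * x}"

abbreviation bicommutant :: "'v::complex_vector endo set \<Rightarrow> 'v endo set"
  where "bicommutant G \<equiv> commutant (commutant G)"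

lemma commutant_closed:
  shows "x \<in> commutant G \<Longrightarrow> y \<in> commutant G \<Longrightarrow> x + y \<in> commutant G"
    and "x \<in> commutant G \<Longrightarrow> y \<in> commutant G \<Longrightarrow> x - y \<in> commutant G"
    and "x \<in> commutant G \<Longrightarrow> y \<in> commutant G \<Longrightarrow> x * y \<in> commutant G"
    and "x \<in> commutant G \<Longrightarrow> a *\<^sub>C x \<in> commutant G"
    and "1 \<in> commutant G"
proof -
  assume "x \<in> commutant G" "y \<in> commutant G"
  then have xy: "x * g = g * x" "y * g = g * y" if "g \<in> G" for g
    using that by (simp_all add: commutant_def)
  have "x * y * g = g * (x * y)" if "g \<in> G" for g
    using xy[OF that] by (metis mult.assoc)
  then show "x * y \<in> commutant G" by (simp add: commutant_def)
qed (auto simp: commutant_def algebra_simps endo_scaleC_mult)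

lemma subset_bicommutant: "G \<subseteq> bicommutant G"
  by (auto simp: commutant_def)

lemma bicommutant_commute:
  assumes "G \<subseteq> commutant G" "x \<in> bicommutant G" "y \<in> bicommutant G"
  shows "x * y = y * x"
proof -
  have "x * g = g * x" if "g \<in> G" for g
  proof -
    have "g \<in> commutant G" using assms(1) that by blast
    then show ?thesis using assms(2) unfolding commutant_def[of "commutant G"] by blast
  qed
  then have "x \<in> commutant G" by (simp add: commutant_def)
  then show ?thesis using assms(3) by (auto simp: commutant_def[of "commutant G"])
qed

text \<open>By the Jacobi identity, the commutator with \<open>d\<close> preserves first the commutant and then the
  bicommutant.\<close>
lemma commutator_bicommutant:
  assumes "\<And>g. g \<in> G \<Longrightarrow> d * g - g * d \<in> bicommutant G" "x \<in> bicommutant G"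
  shows "d * x - x * d \<in> bicommutant G"
proof -
  have ad: "d * c - c * d \<in> commutant G" if c: "c \<in> commutant G" for c
  proof -
    have "(d * c - c * d) * g = g * (d * c - c * d)" if "g \<in> G" for g
    proof -
      have 1: "c * g = g * c" using c that by (simp add: commutant_def)
      have 2: "(d * g - g * d) * c = c * (d * g - g * d)"
        using assms(1)[OF that] c by (auto simp: commutant_def[of "commutant G"])
      have "(d * c - c * d) * g - g * (d * c - c * d)
          = d * (c * g - g * c) - (c * g - g * c) * d - (c * (d * g - g * d) - (d * g - g * d) * c)"
        by (simp add: algebra_simps)
      then show ?thesis using 1 2 by simp
    qed
    then show ?thesis by (simp add: commutant_def)
  qed
  have "(d * x - x * d) * c = c * (d * x - x * d)" if c: "c \<in> commutant G" for c
  proof -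
    have 1: "x * c = c * x" using assms(2) c by (auto simp: commutant_def[of "commutant G"])
    have 2: "(d * c - c * d) * x = x * (d * c - c * d)"
      using assms(2) ad[OF c] by (auto simp: commutant_def[of "commutant G"])
    have "(d * x - x * d) * c - c * (d * x - x * d)
        = d * (x * c - c * x) - (x * c - c * x) * d - (x * (d * c - c * d) - (d * c - c * d) * x)"
      by (simp add: algebra_simps)
    then show ?thesis using 1 2 by simp
  qed
  then show ?thesis by (simp add: commutant_def[of "commutant G"])
qed

text \<open>A locally nilpotent operator kills some nonzero vector of \<open>M\<close>, so its image needs fewer
  generators than \<open>M\<close>.\<close>
lemma locally_nilpotent_bound:
  fixes x :: "'v::complex_vector endo"
  assumes "\<And>v. \<exists>k. x ^ k \<triangleright> v = 0"
    and "csubspace M" "\<And>v. v \<in> M \<Longrightarrow> x \<triangleright> v \<in> M" "finite S" "M \<subseteq> cspan S"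
  shows "\<forall>v\<in>M. x ^ card S \<triangleright> v = 0"
  using assms(2-)
proof (induction "card S" arbitrary: S M rule: less_induct)
  case less
  show ?case
  proof (cases "M \<subseteq> {0}")
    case True
    then show ?thesis by (auto simp: endo_rules)
  next
    case False
    then obtain c where c: "c \<in> M" "c \<noteq> 0" by blast
    define k where "k = (LEAST k. x ^ k \<triangleright> c = 0)"
    have k: "x ^ k \<triangleright> c = 0" unfolding k_def using assms(1) by (rule LeastI_ex)
    then obtain j where j: "k = Suc j" using c by (cases k) (auto simp: endo_apply_simps)
    have "x ^ j \<triangleright> c \<noteq> 0" using not_less_Least[of j "\<lambda>k. x ^ k \<triangleright> c = 0"] j by (simp add: k_def)
    moreover have "x ^ i \<triangleright> c \<in> M" for i
      by (induction i) (use c less.prems in \<open>auto simp: endo_apply_simps\<close>)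
    ultimately have "x ^ j \<triangleright> c \<in> M - {0}" by blast
    moreover have "x \<triangleright> x ^ j \<triangleright> c \<in> {0}" using k by (simp add: j endo_apply_simps)
    moreover have "M \<subseteq> cspan (S \<union> {0})" using less.prems(4) by simp
    moreover have "csubspace {0::'v}" by simp
    moreover have "x \<triangleright> v \<in> {0}" if "v \<in> {0}" for v using that by (simp add: endo_rules)
    ultimately obtain S' where S': "finite S'" "card S' < card S"
        "endo_apply x ` M \<subseteq> cspan (S' \<union> {0})"
      using image_smaller_of_kernel[OF clinear_endo_apply, of "{0}" x S M] less.prems(3) by metis
    have "\<forall>v\<in>endo_apply x ` M. x ^ card S' \<triangleright> v = 0"
      using less.prems S' csubspace_image[OF clinear_endo_apply]
      by (intro less.hyps) auto
    then have "x ^ Suc (card S') \<triangleright> v = 0" if "v \<in> M" for v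
      using that unfolding power_Suc2 by (simp add: endo_apply_simps)
    moreover have "x ^ card S = x ^ (card S - Suc (card S')) * x ^ Suc (card S')"
      using S'(2) by (subst power_add[symmetric]) simp
    ultimately show ?thesis by (simp add: endo_apply_simps endo_rules del: power_Suc)
  qed
qed

section \<open>Commuting operators on a bounded irreducible module\<close>

text \<open>The bilinear form \<open>(u|m)\<close>.\<close>
definition pairing :: "complex ^ 'n \<Rightarrow> int ^ 'n::finite \<Rightarrow> complex"
  where "pairing u m = (\<Sum>i\<in>UNIV. u $ i * of_int (m $ i))"

lemma pairing_axis [simp]: "pairing (axis i a) m = a * of_int (m $ i)"
  by (simp add: pairing_def axis_def if_distrib[of "\<lambda>a. a * _"] cong: if_cong)

lemma pairing_axis_right [simp]: "pairing u (axis i a) = u $ i * of_int a"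
  by (simp add: pairing_def axis_def if_distrib[of of_int] if_distrib[of "\<lambda>a. _ * a"] cong: if_cong)

lemma pairing_simps [simp]: "pairing u 0 = 0" "pairing u (m + k) = pairing u m + pairing u k"
    "pairing u (- m) = - pairing u m"
  by (simp_all add: pairing_def algebra_simps sum.distrib sum_negf)

lemma pairing_eq_1:
  assumes "m \<noteq> 0" obtains u where "pairing u m = 1"
proof -
  obtain i where "m $ i \<noteq> 0" using assms by (metis vec_eq_iff zero_index)
  then have "pairing (axis i (1 / of_int (m $ i))) m = 1" by simp
  then show ?thesis by (rule that)
qed

definition lattice_weight :: "int ^ 'n::finite \<Rightarrow> complex ^ 'n"
  where "lattice_weight m = (\<chi> i. of_int (m $ i))"

lemma lattice_weight_simps [simp]: "lattice_weight 0 = 0"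
    "lattice_weight (m + k) = lattice_weight m + lattice_weight k"
  by (simp_all add: lattice_weight_def vec_eq_iff)

text \<open>The operators of the monomials \<open>t\<^sup>m \<otimes> b\<close> and \<open>D(u,r) \<otimes> b\<close>, with their commutation relations.
  \<open>D (axis i 1) 0 1\<close> is the operator of \<open>d\<^sub>i \<otimes> 1\<close>, so the sets \<open>W \<mu>\<close> are the weight spaces.\<close>
locale bounded_current_module =
  fixes T :: "int ^ 'n::finite \<Rightarrow> 'b::complex_comm_algebra \<Rightarrow> 'v::complex_vector endo"
    and D :: "complex ^ 'n \<Rightarrow> int ^ 'n \<Rightarrow> 'b \<Rightarrow> 'v endo"
    and W :: "complex ^ 'n \<Rightarrow> 'v set"
  assumes T_linear: "clinear (T m)"
    and D_linear: "clinear (D u r)"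
    and D_add: "D (u + v) r b = D u r b + D v r b"
    and D_scale: "D (a *s u) r b = a *\<^sub>C D u r b"
    and T_T: "T m b * T k c = T k c * T m b"
    and D_T: "D u r b * T m c - T m c * D u r b = pairing u m *\<^sub>C T (r + m) (b * c)"
    and D_D: "D u r b * D v s c - D v s c * D u r b
      = D (pairing u s *s v - pairing v r *s u) (r + s) (b * c)"
    and T_one: "T 0 1 = 1"
    and irreducible: "csubspace U \<Longrightarrow> (\<And>m b v. v \<in> U \<Longrightarrow> T m b \<triangleright> v \<in> U) \<Longrightarrow>
      (\<And>u r b v. v \<in> U \<Longrightarrow> D u r b \<triangleright> v \<in> U) \<Longrightarrow> U = {0} \<or> U = UNIV"
    and W_def: "W \<mu> = {v. \<forall>i. D (axis i 1) 0 1 \<triangleright> v = (\<mu> $ i) *\<^sub>C v}"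
    and weight_exists: "\<exists>\<mu>. \<exists>v\<in>W \<mu>. v \<noteq> 0"
    and W_bounded: "\<exists>N. \<forall>\<mu>. \<exists>S. finite S \<and> card S \<le> N \<and> W \<mu> \<subseteq> cspan S"
begin

lemmas T_rules = clinear_rules[OF T_linear]
lemmas D_rules = clinear_rules[OF D_linear]

lemma one_neq_zero_endo: "(1 :: 'v endo) \<noteq> 0"
proof
  assume "(1 :: 'v endo) = 0"
  then have "(1 :: 'v endo) \<triangleright> v = 0 \<triangleright> v" for v by simp
  then show False using weight_exists by (auto simp: endo_apply_simps)
qed

lemma csubspace_W: "csubspace (W \<mu>)"
  by (auto simp: complex_vector.subspace_def W_def endo_rules scaleC_add_right scaleC_scaleC
      mult.commute)

definition homogeneous :: "int ^ 'n \<Rightarrow> 'v endo \<Rightarrow> bool"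
  where "homogeneous m x \<longleftrightarrow> (\<forall>\<mu>. \<forall>v\<in>W \<mu>. x \<triangleright> v \<in> W (\<mu> + lattice_weight m))"

lemma homogeneousI:
  assumes "\<And>i. D (axis i 1) 0 1 * x - x * D (axis i 1) 0 1 = of_int (m $ i) *\<^sub>C x"
  shows "homogeneous m x"
  unfolding homogeneous_def
proof safe
  fix \<mu> v assume v: "v \<in> W \<mu>"
  have "D (axis i 1) 0 1 \<triangleright> x \<triangleright> v = x \<triangleright> D (axis i 1) 0 1 \<triangleright> v + of_int (m $ i) *\<^sub>C x \<triangleright> v" for i
  proof -
    have "(D (axis i 1) 0 1 * x - x * D (axis i 1) 0 1) \<triangleright> v = (of_int (m $ i) *\<^sub>C x) \<triangleright> v"
      using assms by simp
    then show ?thesis by (simp add: endo_apply_simps algebra_simps)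
  qed
  then show "x \<triangleright> v \<in> W (\<mu> + lattice_weight m)"
    using v by (simp add: W_def endo_rules lattice_weight_def scaleC_add_left)
qed

lemma homogeneous_T: "homogeneous m (T m b)"
  by (rule homogeneousI) (simp add: D_T)

lemma homogeneous_D: "homogeneous r (D u r b)"
  by (rule homogeneousI) (simp add: D_D D_scale)

lemma homogeneous_mult: "homogeneous m x \<Longrightarrow> homogeneous k y \<Longrightarrow> homogeneous (m + k) (x * y)"
  by (auto simp: homogeneous_def endo_apply_simps algebra_simps)
    (metis add.commute add.left_commute)

lemma homogeneous_diff: "homogeneous m x \<Longrightarrow> homogeneous m y \<Longrightarrow> homogeneous m (x - y)"
  by (auto simp: homogeneous_def endo_apply_simps complex_vector.subspace_diff[OF csubspace_W])

lemma homogeneous_scaleC: "homogeneous m x \<Longrightarrow> homogeneous m (a *\<^sub>C x)"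
  by (auto simp: homogeneous_def endo_apply_simps complex_vector.subspace_scale[OF csubspace_W])

lemma homogeneous_one: "homogeneous 0 1"
  by (simp add: homogeneous_def endo_apply_simps)

lemma homogeneous_commutator: "homogeneous m x \<Longrightarrow> homogeneous (r + m) (D u r b * x - x * D u r b)"
  using homogeneous_mult[OF homogeneous_D] homogeneous_mult[OF _ homogeneous_D]
  by (metis add.commute homogeneous_diff)

text \<open>By irreducibility all weights lie in one coset of the lattice; the proof works from an arbitrary
  weight in it.\<close>
definition base_weight :: "complex ^ 'n"
  where "base_weight = (SOME \<mu>. \<exists>v\<in>W \<mu>. v \<noteq> 0)"

lemma base_weight: "\<exists>v\<in>W base_weight. v \<noteq> 0"
  unfolding base_weight_def using weight_exists by (rule someI_ex)

text \<open>The span of these weight spaces is stable under all homogeneous operators, hence a submodule.\<close>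
lemma span_weights: "cspan (\<Union>k. W (base_weight + lattice_weight k)) = UNIV"
proof -
  let ?U = "\<Union>k. W (base_weight + lattice_weight k)"
  have stable: "x \<triangleright> v \<in> cspan ?U" if x: "homogeneous m x" and v: "v \<in> cspan ?U" for x m v
    using v
  proof (induction rule: complex_vector.span_induct)
    case base
    show ?case
      by (auto simp: complex_vector.subspace_def endo_rules
          complex_vector.span_zero complex_vector.span_add complex_vector.span_scale)
  next
    case (step v)
    then obtain k where "v \<in> W (base_weight + lattice_weight k)" by blast
    then have "x \<triangleright> v \<in> W (base_weight + lattice_weight k + lattice_weight m)"
      using x by (simp add: homogeneous_def)
    then have "x \<triangleright> v \<in> W (base_weight + lattice_weight (k + m))"
      by (simp add: add.assoc)
    then show ?case by (intro complex_vector.span_base) blast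
  qed
  have "cspan ?U = {0} \<or> cspan ?U = UNIV"
    by (rule irreducible) (auto intro: stable homogeneous_T homogeneous_D)
  moreover have "cspan ?U \<noteq> {0}"
  proof -
    obtain v where "v \<in> W (base_weight + lattice_weight 0)" "v \<noteq> 0" using base_weight by auto
    then have "v \<in> cspan ?U" by (intro complex_vector.span_base) blast
    then show ?thesis using \<open>v \<noteq> 0\<close> by blast
  qed
  ultimately show ?thesis by blast
qed

lemma endo_zeroI:
  assumes "\<And>k v. v \<in> W (base_weight + lattice_weight k) \<Longrightarrow> x \<triangleright> v = 0"
  shows "x = 0"
proof (rule endo_eqI)
  fix v
  have "v \<in> cspan (\<Union>k. W (base_weight + lattice_weight k))" by (simp add: span_weights)
  then have "x \<triangleright> v = 0"
  proof (induction rule: complex_vector.span_induct)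
    case base
    show ?case by (auto simp: complex_vector.subspace_def endo_rules)
  qed (use assms in auto)
  then show "x \<triangleright> v = 0 \<triangleright> v" by (simp add: endo_apply_simps)
qed

text \<open>This is the step that needs one bound for all weight spaces: it makes the exponent independent of
  the vector.\<close>
lemma nilpotent_of_locally_nilpotent:
  assumes "homogeneous 0 x" "\<And>v. \<exists>k. x ^ k \<triangleright> v = 0"
  shows "nilpotent x"
proof -
  obtain N where N: "\<And>\<mu>. \<exists>S. finite S \<and> card S \<le> N \<and> W \<mu> \<subseteq> cspan S"
    using W_bounded by blast
  have "x ^ N = 0"
  proof (rule endo_zeroI)
    fix k v assume v: "v \<in> W (base_weight + lattice_weight k)"
    obtain S where S: "finite S" "card S \<le> N" "W (base_weight + lattice_weight k) \<subseteq> cspan S"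
      using N by blast
    have "x ^ card S \<triangleright> v = 0"
      using locally_nilpotent_bound[OF assms(2) csubspace_W _ S(1,3)] assms(1) v
      by (auto simp: homogeneous_def)
    moreover have "x ^ N = x ^ (N - card S) * x ^ card S"
      using S(2) by (subst power_add[symmetric]) simp
    ultimately show "x ^ N \<triangleright> v = 0" by (simp add: endo_apply_simps endo_rules)
  qed
  then show ?thesis by (auto simp: nilpotent_def)
qed

text \<open>The commuting sets whose bicommutant is stable under commutators with all \<open>D u r b\<close>. Besides the
  set of all \<open>T m b\<close>, one enlargement of it by derivations is needed later.\<close>
definition stable_commuting :: "'v endo set \<Rightarrow> bool"
  where "stable_commuting G \<longleftrightarrow> G \<subseteq> commutant G \<and> (\<forall>m b. T m b \<in> G) \<and>
    (\<forall>u r b. \<forall>g\<in>G. D u r b * g - g * D u r b \<in> bicommutant G)"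

lemma stable_commuting_T: "stable_commuting {T m b |m b. True}"
proof -
  let ?G = "{T m b |m b. True}"
  have "D u r b * T m c - T m c * D u r b \<in> bicommutant ?G" for u r b m c
    unfolding D_T using subset_bicommutant[of ?G] by (intro commutant_closed) auto
  then show ?thesis
    by (auto simp: stable_commuting_def) (auto simp: commutant_def T_T)
qed

context
  fixes G assumes G: "stable_commuting G"
begin

lemma T_bicommutant: "T m b \<in> bicommutant G"
  using G subset_bicommutant[of G] by (auto simp: stable_commuting_def)

lemma commute: "x \<in> bicommutant G \<Longrightarrow> y \<in> bicommutant G \<Longrightarrow> x * y = y * x"
  using G bicommutant_commute by (auto simp: stable_commuting_def)

lemma ad_D_bicommutant: "x \<in> bicommutant G \<Longrightarrow> D u r b * x - x * D u r b \<in> bicommutant G"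
  using G commutator_bicommutant[of G "D u r b" x] by (auto simp: stable_commuting_def)

text \<open>The generalised kernel of \<open>x\<close> is a submodule: since \<open>y = [D u r b, x]\<close> commutes with \<open>x\<close>, the
  operators \<open>x ^ (k + 1)\<close> and \<open>D u r b\<close> commute up to a multiple of \<open>y * x ^ k\<close>.\<close>
lemma locally_nilpotent_or_injective:
  assumes x: "x \<in> bicommutant G"
  shows "(\<forall>v. \<exists>k. x ^ k \<triangleright> v = 0) \<or> (\<forall>v. x \<triangleright> v = 0 \<longrightarrow> v = 0)"
proof -
  let ?U = "{v. \<exists>k. x ^ k \<triangleright> v = 0}"
  have mono: "x ^ (i + k) \<triangleright> v = 0" if "x ^ k \<triangleright> v = 0" for i k v
    using that by (simp add: power_add endo_apply_simps endo_rules)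
  have "?U = {0} \<or> ?U = UNIV"
  proof (rule irreducible)
    show "csubspace ?U"
    proof (rule complex_vector.subspaceI)
      show "v + w \<in> ?U" if vw: "v \<in> ?U" "w \<in> ?U" for v w
      proof -
        obtain i j where "x ^ i \<triangleright> v = 0" "x ^ j \<triangleright> w = 0" using vw by blast
        then have "x ^ (j + i) \<triangleright> (v + w) = 0"
          using mono[of i v j] mono[of j w i] by (simp add: endo_rules add.commute)
        then show ?thesis by blast
      qed
    qed (auto simp: endo_rules)
    show "T m b \<triangleright> v \<in> ?U" if v: "v \<in> ?U" for m b v
    proof -
      obtain k where "x ^ k \<triangleright> v = 0" using v by blast
      moreover have "x ^ k * T m b = T m b * x ^ k"
        by (rule power_commuting_commutes) (rule commute[OF x T_bicommutant])
      then have "x ^ k \<triangleright> T m b \<triangleright> v = T m b \<triangleright> x ^ k \<triangleright> v"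
        by (metis times_endo.rep_eq)
      ultimately show ?thesis by (auto simp: endo_rules)
    qed
    show "D u r b \<triangleright> v \<in> ?U" if v: "v \<in> ?U" for u r b v
    proof -
      obtain k where k: "x ^ k \<triangleright> v = 0" using v by blast
      define y where "y = D u r b * x - x * D u r b"
      have xy: "x * y = y * x" unfolding y_def by (intro commute x ad_D_bicommutant)
      have "(D u r b * x ^ Suc k - x ^ Suc k * D u r b) \<triangleright> v = (of_nat (Suc k) *\<^sub>C (x ^ k * y)) \<triangleright> v"
        using commutator_power[OF y_def[symmetric] xy] by simp
      also have "x ^ k * y = y * x ^ k" using xy by (rule power_commuting_commutes)
      finally have "x ^ Suc k \<triangleright> D u r b \<triangleright> v = 0"
        using k mono[OF k, of 1] by (simp add: endo_apply_simps endo_rules)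
      then show ?thesis by blast
    qed
  qed
  moreover have "v \<in> ?U" if "x \<triangleright> v = 0" for v
    using that by (intro CollectI exI[of _ 1]) simp
  ultimately show ?thesis by blast
qed

lemma nilpotent_of_kernel:
  assumes "x \<in> bicommutant G" "homogeneous 0 x" "x \<triangleright> v = 0" "v \<noteq> 0"
  shows "nilpotent x"
  using locally_nilpotent_or_injective[OF assms(1)] assms nilpotent_of_locally_nilpotent by blast

lemma nilpotent_ad_D:
  assumes "x \<in> bicommutant G" "nilpotent x"
  shows "nilpotent (D u r b * x - x * D u r b)"
  using nilpotent_commutator[OF refl _ refl _ assms(2)] commute ad_D_bicommutant assms(1)
  by (metis (no_types, lifting))

lemma nilpotent_mult_bicommutant:
  "x \<in> bicommutant G \<Longrightarrow> nilpotent x \<Longrightarrow> y \<in> bicommutant G \<Longrightarrow> nilpotent (y * x)"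
  by (rule nilpotent_mult) (auto intro: commute)

end

text \<open>Otherwise \<open>x = T m 1 * T (- m) 1\<close> is nilpotent, and so is its commutator
  \<open>y = T (2 m) 1 * T (- m) 1 - T m 1\<close> with a suitable \<open>D u m 1\<close>. Multiplying by \<open>T m 1\<close> expresses the
  square of \<open>T m 1\<close> by \<open>x\<close> and \<open>y\<close>, so \<open>T m 1\<close> is nilpotent. Its commutator with \<open>D u (- m) 1\<close> is the
  identity, which would be nilpotent as well.\<close>
lemma T_injective:
  assumes "T m 1 \<triangleright> v = 0" shows "v = 0"
proof (cases "m = 0")
  case True
  then show ?thesis using assms by (simp add: T_one endo_apply_simps)
next
  case False
  note G = stable_commuting_T
  note T_in = T_bicommutant[OF G] and ncl = commutant_closed
  obtain u where u: "pairing u m = 1" using pairing_eq_1[OF False] .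
  define x where "x = T m 1 * T (- m) 1"
  have x: "x \<in> bicommutant {T m b |m b. True}" unfolding x_def by (intro ncl T_in)
  have "\<not> nilpotent x"
  proof
    assume nil: "nilpotent x"
    define y where "y = D u m 1 * x - x * D u m 1"
    have y: "nilpotent y" unfolding y_def by (rule nilpotent_ad_D[OF G x nil])
    have y_in: "y \<in> bicommutant {T m b |m b. True}"
      unfolding y_def by (rule ad_D_bicommutant[OF G x])
    have "y = (D u m 1 * T m 1 - T m 1 * D u m 1) * T (- m) 1
        + T m 1 * (D u m 1 * T (- m) 1 - T (- m) 1 * D u m 1)"
      by (simp add: y_def x_def algebra_simps)
    also have "\<dots> = T (m + m) 1 * T (- m) 1 - T m 1"
      by (simp add: D_T u T_one scaleC_one endo_scaleC_mult)
    finally have y_eq: "y = T (m + m) 1 * T (- m) 1 - T m 1" .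
    \<comment> \<open>In this identity \<open>x\<close> and \<open>y\<close> are nilpotent, so the right-hand side is.\<close>
    have "T m 1 * T m 1 = T (m + m) 1 * x + ((- 1) *\<^sub>C T m 1) * y"
    proof -
      have "T m 1 * (T (m + m) 1 * T (- m) 1) = T (m + m) 1 * x"
        unfolding x_def using T_T by (metis mult.assoc)
      then show ?thesis
        by (simp add: y_eq endo_scaleC_mult right_diff_distrib scaleC_one)
    qed
    moreover have "nilpotent (T (m + m) 1 * x)" "nilpotent (((- 1) *\<^sub>C T m 1) * y)"
      by (intro nilpotent_mult_bicommutant[OF G] ncl T_in x y_in nil y)+
    then have "nilpotent (T (m + m) 1 * x + ((- 1) *\<^sub>C T m 1) * y)"
      by (rule nilpotent_add) (intro commute[OF G] ncl T_in x y_in)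
    ultimately have "nilpotent (T m 1 * T m 1)" by (simp only:)
    then have "nilpotent (T m 1)" by (rule nilpotent_root)
    then have "nilpotent (D u (- m) 1 * T m 1 - T m 1 * D u (- m) 1)"
      by (intro nilpotent_ad_D[OF G] T_in)
    then have "nilpotent (1 :: 'v endo)" by (simp add: D_T u T_one scaleC_one)
    then show False using one_neq_zero_endo by (auto simp: nilpotent_def)
  qed
  moreover have "homogeneous 0 x"
    using homogeneous_mult[OF homogeneous_T[of m 1] homogeneous_T[of "- m" 1]] by (simp add: x_def)
  moreover have "x \<triangleright> v = 0"
    unfolding x_def T_T[of m] using assms by (simp add: endo_apply_simps endo_rules)
  ultimately show ?thesis using nilpotent_of_kernel[OF G x] by blast
qed

text \<open>Let \<open>v\<^sub>0\<close> be a common eigenvector, with eigenvalues \<open>ev\<close>, of the operators of degree \<open>0\<close> in one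
  weight space. The vectors on which all of them act through \<open>ev\<close> form a submodule: \<open>x - ev x\<close> is not
  injective, hence nilpotent, so \<open>y = [D u r b, x]\<close> is nilpotent too. Then \<open>T (- r) 1 * y\<close> is
  nilpotent of degree \<open>0\<close>, which means that \<open>ev\<close> vanishes on it. Injectivity of \<open>T (- r) 1\<close> shows that \<open>y\<close>
  kills the vectors in question, on which \<open>x\<close> and \<open>D u r b\<close> therefore commute.\<close>
theorem degree_zero_scalar:
  assumes G: "stable_commuting G" and x: "x \<in> bicommutant G" "homogeneous 0 x"
  shows "\<exists>a. x = a *\<^sub>C 1"
proof -
  note T_in = T_bicommutant[OF G] and ncl = commutant_closed
  \<comment> \<open>\<open>R\<close> is the set of operators of degree \<open>0\<close> in the algebra; they preserve each weight space.\<close>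
  define R where "R = {x \<in> bicommutant G. homogeneous 0 x}"
  obtain S where S: "finite S" "W base_weight \<subseteq> cspan S" using W_bounded by blast
  have "\<exists>v\<in>W base_weight - {0}. \<forall>f\<in>endo_apply ` R. \<exists>z. f v - z *\<^sub>C v \<in> {0}"
  proof (rule common_eigenvector_modulo)
    show "f (g v) = g (f v)" if fg: "f \<in> endo_apply ` R" "g \<in> endo_apply ` R" for f g v
    proof -
      obtain x y where "x \<in> R" "y \<in> R" "f = endo_apply x" "g = endo_apply y" using fg by blast
      then show ?thesis using commute[OF G, of x y] by (metis (lifting) R_def mem_Collect_eq times_endo.rep_eq)
    qed
    show "f v \<in> W base_weight" if "f \<in> endo_apply ` R" "v \<in> W base_weight" for f v
    proof -
      obtain x where "x \<in> R" "f = endo_apply x" using \<open>f \<in> endo_apply ` R\<close> by blast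
      then have "f v \<in> W (base_weight + lattice_weight 0)"
        using that(2) by (simp add: R_def homogeneous_def del: lattice_weight_simps)
      then show ?thesis by simp
    qed
    show "{0} \<subseteq> W base_weight" using complex_vector.subspace_0[OF csubspace_W] by simp
    show "{0} \<noteq> W base_weight" using base_weight by blast
    show "W base_weight \<subseteq> cspan (S \<union> {0})" using S by simp
  qed (use S csubspace_W clinear_endo_apply in \<open>auto simp: endo_rules\<close>)
  then obtain v\<^sub>0 where v\<^sub>0: "v\<^sub>0 \<noteq> 0" "\<forall>x\<in>R. \<exists>a. x \<triangleright> v\<^sub>0 = a *\<^sub>C v\<^sub>0" by auto
  then obtain ev where ev: "\<And>x. x \<in> R \<Longrightarrow> x \<triangleright> v\<^sub>0 = ev x *\<^sub>C v\<^sub>0" by metis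
  have nil: "nilpotent (x - ev x *\<^sub>C 1)" if "x \<in> R" for x
  proof (rule nilpotent_of_kernel[OF G _ _ _ v\<^sub>0(1)])
    show "x - ev x *\<^sub>C 1 \<in> bicommutant G" "homogeneous 0 (x - ev x *\<^sub>C 1)"
      using that unfolding R_def
      by (auto intro!: ncl homogeneous_diff homogeneous_scaleC homogeneous_one)
    show "(x - ev x *\<^sub>C 1) \<triangleright> v\<^sub>0 = 0" using ev[OF that] by (simp add: endo_apply_simps)
  qed
  have ev_nil: "ev x = 0" if R: "x \<in> R" and nil: "nilpotent x" for x
  proof -
    obtain k where k: "x ^ k = 0" using nil by (auto simp: nilpotent_def)
    have "x ^ j \<triangleright> v\<^sub>0 = ev x ^ j *\<^sub>C v\<^sub>0" for j
      by (induction j)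
        (simp_all add: endo_apply_simps endo_rules scaleC_one ev[OF R] scaleC_scaleC mult.commute)
    from this[of k] show ?thesis using k v\<^sub>0(1) by (simp add: endo_apply_simps)
  qed
  let ?U = "{v. \<forall>x\<in>R. x \<triangleright> v = ev x *\<^sub>C v}"
  have "?U = {0} \<or> ?U = UNIV"
  proof (rule irreducible)
    show "csubspace ?U"
      by (auto simp: complex_vector.subspace_def endo_rules scaleC_add_right scaleC_scaleC mult.commute)
    show "T m b \<triangleright> v \<in> ?U" if "v \<in> ?U" for m b v
    proof -
      have "x \<triangleright> T m b \<triangleright> v = T m b \<triangleright> x \<triangleright> v" if "x \<in> R" for x
        using commute[OF G _ T_in, of x m b] that by (metis (lifting) R_def mem_Collect_eq times_endo.rep_eq)
      then show ?thesis using that by (simp add: endo_rules)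
    qed
    show "D u r b \<triangleright> v \<in> ?U" if v: "v \<in> ?U" for u r b v
    proof -
      have "x \<triangleright> D u r b \<triangleright> v = ev x *\<^sub>C D u r b \<triangleright> v" if x: "x \<in> R" for x
      proof -
        define y where "y = D u r b * x - x * D u r b"
        have "y = D u r b * (x - ev x *\<^sub>C 1) - (x - ev x *\<^sub>C 1) * D u r b"
          by (simp add: y_def algebra_simps endo_scaleC_mult)
        moreover have "nilpotent (D u r b * (x - ev x *\<^sub>C 1) - (x - ev x *\<^sub>C 1) * D u r b)"
          using x by (intro nilpotent_ad_D[OF G] ncl nil) (auto simp: R_def)
        ultimately have "nilpotent y" by simp
        have y_in: "y \<in> bicommutant G"
          using x unfolding y_def by (intro ad_D_bicommutant[OF G]) (auto simp: R_def)
        have "homogeneous r y"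
          using homogeneous_commutator[of 0 x r u b] x by (simp add: y_def R_def)
        then have "homogeneous 0 (T (- r) 1 * y)"
          using homogeneous_mult[OF homogeneous_T, of r y "- r" 1] by simp
        then have "T (- r) 1 * y \<in> R"
          using y_in by (auto simp: R_def intro!: ncl T_in)
        moreover have "nilpotent (T (- r) 1 * y)"
          by (intro nilpotent_mult_bicommutant[OF G] y_in \<open>nilpotent y\<close> T_in)
        ultimately have "(T (- r) 1 * y) \<triangleright> v = 0 *\<^sub>C v" using v ev_nil by fastforce
        then have "y \<triangleright> v = 0" using T_injective by (simp add: endo_apply_simps)
        then show ?thesis using v x by (simp add: y_def endo_apply_simps endo_rules)
      qed
      then show ?thesis by blast
    qed
  qed
  moreover have "v\<^sub>0 \<in> ?U" using ev by blast
  ultimately have "?U = UNIV" using v\<^sub>0(1) by blast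
  then have "y \<triangleright> v = (ev y *\<^sub>C 1) \<triangleright> v" if "y \<in> R" for y v
    using that by (auto simp: endo_apply_simps)
  moreover have "x \<in> R" using x by (simp add: R_def)
  ultimately show ?thesis by (metis endo_eqI)
qed

section \<open>Evaluation on the Laurent polynomials\<close>

lemma T_neq_zero: "T m 1 \<noteq> 0"
  using T_injective[of m] weight_exists by (auto simp: endo_apply_simps)

lemma T_inverse: "\<exists>a. a \<noteq> 0 \<and> T m 1 * T (- m) 1 = a *\<^sub>C 1"
proof -
  note G = stable_commuting_T
  have "homogeneous 0 (T m 1 * T (- m) 1)"
    using homogeneous_mult[OF homogeneous_T[of m 1] homogeneous_T[of "- m" 1]] by simp
  then obtain a where a: "T m 1 * T (- m) 1 = a *\<^sub>C 1"
    using degree_zero_scalar[OF G commutant_closed(3)[OF T_bicommutant[OF G] T_bicommutant[OF G]]]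
    by blast
  moreover have "a \<noteq> 0"
  proof
    assume "a = 0"
    obtain v :: 'v where v: "v \<noteq> 0" using weight_exists by blast
    have "T m 1 \<triangleright> T (- m) 1 \<triangleright> v = 0"
      using a \<open>a = 0\<close> by (metis complex_vector.scale_zero_left times_endo.rep_eq zero_endo.rep_eq)
    then show False using v T_injective[OF T_injective] by blast
  qed
  ultimately show ?thesis by blast
qed

text \<open>Multiplication by \<open>T (- m) 1\<close>, which \<open>T_inverse\<close> allows to undo, reduces this to degree \<open>0\<close>.\<close>
lemma homogeneous_multiple_of_T:
  assumes G: "stable_commuting G" and x: "x \<in> bicommutant G" "homogeneous m x"
  shows "\<exists>a. x = a *\<^sub>C T m 1"
proof -
  obtain a where a: "a \<noteq> 0" "T m 1 * T (- m) 1 = a *\<^sub>C 1" using T_inverse by blast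
  have "homogeneous 0 (T (- m) 1 * x)"
    using homogeneous_mult[OF homogeneous_T x(2), of "- m" 1] by simp
  then obtain c where c: "T (- m) 1 * x = c *\<^sub>C 1"
    using degree_zero_scalar[OF G commutant_closed(3)[OF T_bicommutant[OF G] x(1)]] by blast
  have "a *\<^sub>C x = (T m 1 * T (- m) 1) * x" by (simp add: a endo_scaleC_mult)
  also have "\<dots> = c *\<^sub>C T m 1" by (simp add: mult.assoc c endo_scaleC_mult)
  finally have "(1 / a) *\<^sub>C (a *\<^sub>C x) = (1 / a) *\<^sub>C (c *\<^sub>C T m 1)" by simp
  then show ?thesis using a(1) by (auto simp: scaleC_scaleC scaleC_one)
qed

text \<open>\<open>\<eta>\<close> is read off from one lattice vector \<open>e\<close>. The commutator of \<open>T e b = \<eta> b *\<^sub>C T e 1\<close> with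
  \<open>D u (k - e) c\<close> transports the factor \<open>\<eta> b\<close> to every other lattice vector \<open>k\<close> and every \<open>c\<close>.\<close>
theorem T_evaluation: "\<exists>\<eta>. algebra_hom \<eta> \<and> (\<forall>m b. T m b = \<eta> b *\<^sub>C T m 1)"
proof -
  define e :: "int ^ 'n" where "e = axis undefined 1"
  define u :: "complex ^ 'n" where "u = axis undefined 1"
  have u: "pairing u e = 1" by (simp add: u_def e_def)
  have "\<exists>a. T e b = a *\<^sub>C T e 1" for b
    by (intro homogeneous_multiple_of_T[OF stable_commuting_T] T_bicommutant stable_commuting_T
        homogeneous_T)
  then obtain \<eta> where \<eta>: "\<And>b. T e b = \<eta> b *\<^sub>C T e 1" by metis
  have key: "T k (b * c) = \<eta> b *\<^sub>C T k c" for k b c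
  proof -
    have "T k (b * c) = D u (k - e) c * T e b - T e b * D u (k - e) c"
      by (simp add: D_T u scaleC_one mult.commute)
    also have "\<dots> = \<eta> b *\<^sub>C (D u (k - e) c * T e 1 - T e 1 * D u (k - e) c)"
      by (simp add: \<eta>[of b] endo_scaleC_mult complex_vector.scale_right_diff_distrib)
    also have "\<dots> = \<eta> b *\<^sub>C T k c" by (simp add: D_T u scaleC_one)
    finally show ?thesis .
  qed
  have T: "T m b = \<eta> b *\<^sub>C T m 1" for m b
    using key[of m b 1] by simp
  have cancel: "a = c" if "a *\<^sub>C T e 1 = c *\<^sub>C T e 1" for a c
    using that T_neq_zero[of e] by simp
  have "\<eta> (b + c) = \<eta> b + \<eta> c" for b c
    by (rule cancel) (metis \<eta> T_rules(1) scaleC_add_left)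
  moreover have "\<eta> (a *\<^sub>C b) = a * \<eta> b" for a b
    by (rule cancel) (metis \<eta> T_rules(2) scaleC_scaleC)
  moreover have "\<eta> 1 = 1"
    by (rule cancel) (metis \<eta> scaleC_one)
  moreover have "\<eta> (b * c) = \<eta> b * \<eta> c" for b c
    by (rule cancel) (metis \<eta> key scaleC_scaleC)
  ultimately have "algebra_hom \<eta>"
    by (auto simp: algebra_hom_def intro!: clinearI)
  then show ?thesis using T by blast
qed

section \<open>Vanishing of the derivations over the kernel of evaluation\<close>

text \<open>\<open>T (- k) 1\<close> carries any weight space into the base one and is injective.\<close>
lemma vanishes_if_zero_on_base_weight:
  assumes "\<And>k. x * T k 1 = T k 1 * x" "\<And>v. v \<in> W base_weight \<Longrightarrow> x \<triangleright> v = 0"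
  shows "x = 0"
proof (rule endo_zeroI)
  fix k v assume "v \<in> W (base_weight + lattice_weight k)"
  then have "T (- k) 1 \<triangleright> v \<in> W (base_weight + lattice_weight k + lattice_weight (- k))"
    using homogeneous_T by (auto simp: homogeneous_def)
  then have "T (- k) 1 \<triangleright> v \<in> W base_weight"
    using lattice_weight_simps(2)[of k "- k"] by (simp add: add.assoc)
  then have "x \<triangleright> T (- k) 1 \<triangleright> v = 0" by (rule assms(2))
  then have "T (- k) 1 \<triangleright> x \<triangleright> v = 0" using assms(1) by (metis times_endo.rep_eq)
  then show "x \<triangleright> v = 0" by (rule T_injective)
qed

text \<open>For nonzero \<open>s\<close>, the element \<open>D(axis i 1, axis i s)\<close> generates the Witt algebra as an ideal: commutators with
  \<open>D w (- axis i s) 1\<close> yield everything of degree \<open>0\<close>, and from there every other degree is reached.\<close>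
lemma D_zero_propagates:
  fixes s :: int
  assumes "s \<noteq> 0" "D (axis i 1) (axis i s) c = 0"
  shows "D u r c = 0"
proof -
  have "s *\<^sub>C (w $ i *\<^sub>C D (axis i 1) 0 c + D w 0 c) = 0" for w
  proof -
    have "0 = D w (- axis i s) 1 * D (axis i 1) (axis i s) c
        - D (axis i 1) (axis i s) c * D w (- axis i s) 1"
      by (simp add: assms)
    also have "\<dots> = D ((w $ i * s) *s axis i 1 + of_int s *s w) 0 c"
      by (simp add: D_D vector_smult_lneg)
    also have "\<dots> = s *\<^sub>C (w $ i *\<^sub>C D (axis i 1) 0 c + D w 0 c)"
      by (simp add: D_add D_scale scaleC_add_right scaleC_scaleC mult.commute)
    finally show ?thesis by simp
  qed
  then have sum: "w $ i *\<^sub>C D (axis i 1) 0 c + D w 0 c = 0" for w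
    using assms(1) by (simp add: complex_vector.scale_eq_0_iff)
  have "2 *\<^sub>C D (axis i 1) 0 c = 0"
    using sum[of "axis i 1"] scaleC_add_left[of 1 1 "D (axis i 1) 0 c"] by (simp add: scaleC_one)
  then have "D (axis i 1) 0 c = 0" by (simp add: complex_vector.scale_eq_0_iff)
  then have zero: "D w 0 c = 0" for w using sum[of w] by simp
  show ?thesis
  proof (cases "r = 0")
    case False
    obtain v where v: "pairing v r = 1" using pairing_eq_1[OF False] .
    have "0 = D v 0 c * D u r 1 - D u r 1 * D v 0 c" by (simp add: zero)
    also have "\<dots> = D u r c" by (simp add: D_D v)
    finally show ?thesis by simp
  qed (simp add: zero)
qed

text \<open>Commuting \<open>D ?a ?e c\<close> with \<open>D ?a 0 b\<close> multiplies \<open>c\<close> by \<open>b\<close> and leaves the degree \<open>?e\<close> unchanged.\<close>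
lemma D_annihilator_ideal:
  assumes "\<And>u r. D u r c = 0"
  shows "D u r (b * c) = 0"
proof (rule D_zero_propagates[of 1 undefined])
  let ?a = "axis undefined 1 :: complex ^ 'n" and ?e = "axis undefined 1 :: int ^ 'n"
  have "0 = D ?a 0 b * D ?a ?e c - D ?a ?e c * D ?a 0 b" by (simp add: assms)
  also have "\<dots> = D ?a ?e (b * c)" by (simp add: D_D)
  finally show "D ?a ?e (b * c) = 0" by simp
qed simp

context
  fixes \<eta> assumes hom: "algebra_hom \<eta>" and T_eta: "\<And>m b. T m b = \<eta> b *\<^sub>C T m 1"
begin

lemma eta_rules: "\<eta> (b + c) = \<eta> b + \<eta> c" "\<eta> (a *\<^sub>C b) = a * \<eta> b" "\<eta> (b - c) = \<eta> b - \<eta> c"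
    "\<eta> 0 = 0" "\<eta> 1 = 1" "\<eta> (b * c) = \<eta> b * \<eta> c"
  using hom by (auto simp: algebra_hom_def clinear_rules)

lemma D_T_commute:
  assumes "\<eta> c = 0"
  shows "D u r c * T m b = T m b * D u r c"
  using D_T[of u r c m b] T_eta[of "r + m" "c * b"] assms by (simp add: eta_rules)

definition annihilator :: "'b set"
  where "annihilator = {c. \<eta> c = 0 \<and> (\<forall>u r. D u r c = 0)}"

text \<open>By \<open>D_zero_propagates\<close> a single operator \<open>D ?a ?e c\<close> detects whether \<open>c\<close> lies in the annihilator.
  Since it commutes with the \<open>T k 1\<close>, it is determined by its values on a basis of one weight space,
  and these lie in another finite-dimensional weight space.\<close>
lemma annihilator_finite_codimension:
  "\<exists>S. finite S \<and> {c. \<eta> c = 0} \<subseteq> cspan (S \<union> annihilator)"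
proof -
  let ?a = "axis undefined 1 :: complex ^ 'n" and ?e = "axis undefined 1 :: int ^ 'n"
  let ?M = "{c. \<eta> c = 0}"
  obtain X where X: "finite X" "W base_weight \<subseteq> cspan X" using W_bounded by blast
  obtain B where B: "B \<subseteq> W base_weight" "complex_vector.independent B" "W base_weight \<subseteq> cspan B"
    by (rule complex_vector.maximal_independent_subset)
  have finB: "finite B"
    using complex_vector.independent_span_bound[OF X(1) B(2)] B(1) X(2) by blast
  obtain Y where Y: "finite Y" "W (base_weight + lattice_weight ?e) \<subseteq> cspan Y"
    using W_bounded by blast
  have "\<exists>S. finite S \<and> ?M \<subseteq> cspan (S \<union> {c \<in> ?M. \<forall>v\<in>B. D ?a ?e c \<triangleright> v = 0})"
  proof (rule finite_codimension_common_kernel[OF finB _ _ _ Y(1)])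
    show "clinear (\<lambda>c. D ?a ?e c \<triangleright> v)" for v
      by (rule clinearI) (simp_all add: D_rules endo_apply_simps)
    show "csubspace ?M" by (auto simp: complex_vector.subspace_def eta_rules)
    show "(\<lambda>c. D ?a ?e c \<triangleright> v) ` ?M \<subseteq> cspan Y" if "v \<in> B" for v
    proof safe
      fix c
      have "v \<in> W base_weight" using that B(1) by blast
      then have "D ?a ?e c \<triangleright> v \<in> W (base_weight + lattice_weight ?e)"
        using homogeneous_D[of ?e ?a c] unfolding homogeneous_def by blast
      then show "D ?a ?e c \<triangleright> v \<in> cspan Y" using Y(2) by blast
    qed
  qed
  moreover have "{c \<in> ?M. \<forall>v\<in>B. D ?a ?e c \<triangleright> v = 0} \<subseteq> annihilator"
  proof safe
    fix c assume c: "\<eta> c = 0" "\<forall>v\<in>B. D ?a ?e c \<triangleright> v = 0"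
    have "D ?a ?e c \<triangleright> v = 0" if "v \<in> cspan B" for v
      using that
    proof (induction rule: complex_vector.span_induct)
      case base
      show ?case by (auto simp: complex_vector.subspace_def endo_rules)
    qed (use c in auto)
    then have "D ?a ?e c = 0"
      using B(3) D_T_commute[OF c(1)] by (intro vanishes_if_zero_on_base_weight) auto
    then have "D u r c = 0" for u r by (rule D_zero_propagates[rotated]) simp
    then show "c \<in> annihilator" using c(1) by (simp add: annihilator_def)
  qed
  ultimately show ?thesis
    by (meson Un_mono complex_vector.span_mono order.refl order.trans)
qed

text \<open>Here \<open>c\<close> is an eigenvector of multiplication by \<open>B\<close> modulo the annihilator, with eigenvalues \<open>\<kappa>\<close>.
  Since \<open>c * c\<close> acts by zero, the \<open>D u r c\<close> commute with each other and can be joined to the \<open>T m b\<close>.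
  Hence \<open>D u 0 c\<close> is a scalar, and its commutators, among which all \<open>D u r c\<close> with nonzero \<open>r\<close> occur,
  are zero.\<close>
lemma square_zero_in_annihilator:
  assumes c: "\<eta> c = 0" and ev: "\<And>b u r. D u r (b * c) = \<kappa> b *\<^sub>C D u r c" and "\<kappa> c = 0"
  shows "c \<in> annihilator"
proof -
  let ?G = "{T m b |m b. True} \<union> {D u r c |u r. True}"
  let ?a = "axis undefined 1 :: complex ^ 'n" and ?e = "axis undefined 1 :: int ^ 'n"
  have G: "stable_commuting ?G"
  proof -
    have "D u r c * D v s c = D v s c * D u r c" for u r v s
      using D_D[of u r c v s c] ev[of _ _ c] assms(3) by simp
    then have "?G \<subseteq> commutant ?G"
      by (auto simp: commutant_def T_T D_T_commute[OF c])
    moreover have "D u r b * T m d - T m d * D u r b \<in> bicommutant ?G" for u r b m d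
      unfolding D_T using subset_bicommutant[of ?G] by (intro commutant_closed(4)) auto
    moreover have "D u r b * D v s c - D v s c * D u r b \<in> bicommutant ?G" for u r b v s
      unfolding D_D ev using subset_bicommutant[of ?G] by (intro commutant_closed(4)) auto
    ultimately show ?thesis by (auto simp: stable_commuting_def)
  qed
  have "D ?a 0 c \<in> bicommutant ?G" using subset_bicommutant[of ?G] by blast
  then obtain a where a: "D ?a 0 c = a *\<^sub>C 1"
    using degree_zero_scalar[OF G _ homogeneous_D] by blast
  have "D ?a ?e c = D ?a 0 c * D ?a ?e 1 - D ?a ?e 1 * D ?a 0 c" by (simp add: D_D)
  also have "\<dots> = 0" by (simp add: a endo_scaleC_mult)
  finally have "D ?a ?e c = 0" .
  then have "D u r c = 0" for u r by (rule D_zero_propagates[rotated]) simp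
  then show ?thesis using c by (simp add: annihilator_def)
qed

text \<open>Here \<open>c\<close> is idempotent up to the factor \<open>\<kappa>\<close>, so \<open>D u r c\<close> acts like \<open>\<kappa>\<close> times a representation of
  the Witt algebra. The operator \<open>Z\<close> of a degree derivation, tensored with \<open>c\<close>, has its eigenvalues shifted by \<open>s * \<kappa>\<close>
  by the operator \<open>Q\<close>, which has degree \<open>0\<close>. On the finite-dimensional base weight space this is impossible for suitable \<open>s\<close>
  unless \<open>Q = 0\<close>.\<close>
lemma quasi_idempotent_in_annihilator:
  assumes c: "\<eta> c = 0" and ev: "\<And>u r. D u r (c * c) = \<kappa> *\<^sub>C D u r c" and "\<kappa> \<noteq> 0"
  shows "c \<in> annihilator"
proof -
  let ?a = "axis undefined 1 :: complex ^ 'n"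
  define Z where "Z = D ?a 0 c"
  have Z_W: "Z \<triangleright> v \<in> W base_weight" if "v \<in> W base_weight" for v
    using that homogeneous_D[of 0 ?a c] by (auto simp: homogeneous_def Z_def)
  obtain S where S: "finite S" "W base_weight \<subseteq> cspan S" using W_bounded by blast
  let ?fold = "fold (\<lambda>z x. Z \<triangleright> x - z *\<^sub>C x)"
  obtain zs where zs: "\<And>v. v \<in> W base_weight \<Longrightarrow> ?fold zs v = 0"
    using product_of_shifts_vanishes[OF clinear_endo_apply csubspace_W Z_W S] by blast
  \<comment> \<open>Choose \<open>s\<close> such that \<open>s * \<kappa>\<close> is not a difference of two entries of \<open>zs\<close>, and nonzero for
    \<open>D_zero_propagates\<close>.\<close>
  have "finite ((\<lambda>(z, y). (z - y) / \<kappa>) ` (set zs \<times> set zs))" by blast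
  moreover have "infinite (of_int ` {1::int..} :: complex set)"
    by (simp add: finite_image_iff inj_on_def infinite_Ici)
  ultimately obtain s :: int where s: "s \<ge> 1"
      "(of_int s :: complex) \<notin> (\<lambda>(z, y). (z - y) / \<kappa>) ` (set zs \<times> set zs)"
    by (metis (no_types, lifting) atLeast_iff finite_subset image_subsetI)
  define e :: "int ^ 'n" where "e = axis undefined s"
  define Q where "Q = T (- e) 1 * D ?a e c"
  have "Z * D ?a e c - D ?a e c * Z = (s * \<kappa>) *\<^sub>C D ?a e c"
    by (simp add: Z_def e_def D_D D_scale ev scaleC_scaleC)
  moreover have "Z * T (- e) 1 = T (- e) 1 * Z" unfolding Z_def by (rule D_T_commute[OF c])
  ultimately have ZQ: "Z * Q = Q * Z + (s * \<kappa>) *\<^sub>C Q"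
    unfolding Q_def by (metis (no_types, lifting) diff_add_cancel add.commute distrib_left endo_scaleC_mult(2) mult.assoc)
  have ZQ_apply: "Z \<triangleright> Q \<triangleright> v = Q \<triangleright> Z \<triangleright> v + (s * \<kappa>) *\<^sub>C Q \<triangleright> v" for v
    using arg_cong[OF ZQ, of "\<lambda>x. x \<triangleright> v"] by (simp add: endo_apply_simps)
  have shifted: "?fold (map (\<lambda>z. z + s * \<kappa>) ys) (Q \<triangleright> v) = Q \<triangleright> ?fold ys v" for ys v
  proof (induction ys arbitrary: v)
    case (Cons a ys)
    have "Z \<triangleright> Q \<triangleright> v - (a + s * \<kappa>) *\<^sub>C Q \<triangleright> v = Q \<triangleright> (Z \<triangleright> v - a *\<^sub>C v)"
      by (simp add: ZQ_apply scaleC_add_left endo_rules)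
    then show ?case using Cons.IH[of "Z \<triangleright> v - a *\<^sub>C v"] by simp
  qed simp
  have Q_zero: "Q \<triangleright> v = 0" if v: "v \<in> W base_weight" for v
  proof (rule disjoint_shifts_eq_zero[OF clinear_endo_apply[of Z]])
    show "?fold (map (\<lambda>z. z + s * \<kappa>) zs) (Q \<triangleright> v) = 0"
      unfolding shifted by (simp add: zs[OF v] endo_rules)
    have "homogeneous (- e + e) Q"
      unfolding Q_def by (intro homogeneous_mult homogeneous_T homogeneous_D)
    then have "Q \<triangleright> v \<in> W base_weight" using v by (auto simp: homogeneous_def)
    then show "?fold zs (Q \<triangleright> v) = 0" by (rule zs)
    show "set (map (\<lambda>z. z + s * \<kappa>) zs) \<inter> set zs = {}"
    proof -
      have False if "z \<in> set zs" "z + s * \<kappa> \<in> set zs" for z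
      proof -
        have "of_int s = (z + s * \<kappa> - z) / \<kappa>" using assms(3) by simp
        then show False using s(2) that by (metis (mono_tags, lifting) SigmaI case_prod_conv image_eqI)
      qed
      then show ?thesis by auto
    qed
  qed
  have "D ?a e c = 0"
  proof (rule vanishes_if_zero_on_base_weight)
    show "D ?a e c * T k 1 = T k 1 * D ?a e c" for k by (rule D_T_commute[OF c])
    show "D ?a e c \<triangleright> v = 0" if "v \<in> W base_weight" for v
      using Q_zero[OF that] T_injective by (simp add: Q_def endo_apply_simps)
  qed
  then have "D u r c = 0" for u r
    using s(1) D_zero_propagates[of s undefined c u r] by (simp add: e_def)
  then show ?thesis using c by (simp add: annihilator_def)
qed

text \<open>A common eigenvector of multiplication by \<open>B\<close> in the kernel of \<open>\<eta>\<close> modulo the annihilator falls under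
  one of the two preceding lemmas, according to whether multiplication by that eigenvector itself has
  eigenvalue zero on it.\<close>
theorem D_vanishes_on_kernel:
  assumes "\<eta> b = 0"
  shows "D u r b = 0"
proof -
  let ?M = "{c. \<eta> c = 0}"
  have "annihilator = ?M"
  proof (rule ccontr)
    assume neq: "annihilator \<noteq> ?M"
    obtain S where S: "finite S" "?M \<subseteq> cspan (S \<union> annihilator)"
      using annihilator_finite_codimension by blast
    have "\<exists>c\<in>?M - annihilator. \<forall>f\<in>range (*). \<exists>z. f c - z *\<^sub>C c \<in> annihilator"
    proof (rule common_eigenvector_modulo[OF _ _ _ _ _ _ _ neq S])
      show "clinear f" if "f \<in> range ((*) :: 'b \<Rightarrow> 'b \<Rightarrow> 'b)" for f
        using that by (auto intro!: clinearI simp: distrib_left scaleC_mult_right)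
      show "f (g x) = g (f x)"
        if "f \<in> range (*)" "g \<in> range (*)" for f g and x :: 'b
        using that by (auto simp: mult.left_commute)
      show "csubspace annihilator" "csubspace ?M"
        by (auto simp: annihilator_def complex_vector.subspace_def D_rules eta_rules)
      show "f x \<in> annihilator" if "f \<in> range (*)" "x \<in> annihilator" for f x
        using that by (auto simp: annihilator_def eta_rules D_annihilator_ideal)
    qed (auto simp: annihilator_def eta_rules)
    then obtain c where c: "\<eta> c = 0" "c \<notin> annihilator"
        "\<forall>b. \<exists>z. b * c - z *\<^sub>C c \<in> annihilator"
      by auto
    then obtain \<kappa> where "\<And>b. b * c - \<kappa> b *\<^sub>C c \<in> annihilator" by metis
    then have ev: "D u r (b * c) = \<kappa> b *\<^sub>C D u r c" for b u r
      by (simp add: annihilator_def D_rules)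
    show False
      using square_zero_in_annihilator[OF c(1) ev] quasi_idempotent_in_annihilator[OF c(1) ev] c(2)
      by blast
  qed
  then show ?thesis using assms by (auto simp: annihilator_def)
qed

end

theorem single_point:
  "\<exists>\<eta>. algebra_hom \<eta> \<and> (\<forall>m b. T m b = \<eta> b *\<^sub>C T m 1) \<and> (\<forall>u r b. D u r b = \<eta> b *\<^sub>C D u r 1)"
proof -
  obtain \<eta> where \<eta>: "algebra_hom \<eta>" "\<And>m b. T m b = \<eta> b *\<^sub>C T m 1"
    using T_evaluation by blast
  have "D u r b = \<eta> b *\<^sub>C D u r 1" for u r b
  proof -
    have "\<eta> (b - \<eta> b *\<^sub>C 1) = 0" using \<eta>(1) by (simp add: algebra_hom_def clinear_rules)
    then have "D u r (b - \<eta> b *\<^sub>C 1) = 0" by (rule D_vanishes_on_kernel[OF \<eta>])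
    then show ?thesis by (simp add: D_rules)
  qed
  then show ?thesis using \<eta> by blast
qed

end

section \<open>Monomial derivations\<close>

definition laurent_times_witt :: "'n::finite laurent \<Rightarrow> 'n witt \<Rightarrow> 'n witt"
  where "laurent_times_witt g D = Abs_witt (\<lambda>f. g * apply_witt D f)"

lemma apply_laurent_times_witt: "apply_witt (laurent_times_witt g D) f = g * apply_witt D f"
proof -
  have "derivation (\<lambda>f. g * apply_witt D f)"
    by (auto simp: derivation_def apply_witt_rules apply_witt_mult laurent_scaleC_mult algebra_simps
        intro!: clinearI)
  then show ?thesis by (simp add: laurent_times_witt_def Abs_witt_inverse)
qed

text \<open>The derivation \<open>D(u,r)\<close>.\<close>
definition witt_monomial :: "complex ^ 'n \<Rightarrow> int ^ 'n::finite \<Rightarrow> 'n witt"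
  where "witt_monomial u r =
    (\<Sum>i\<in>UNIV. u $ i *\<^sub>C laurent_times_witt (Poly_Mapping.single r 1) (degree_derivation i))"

lemma apply_witt_sum: "apply_witt (sum E I) f = (\<Sum>i\<in>I. apply_witt (E i) f)"
  by (induction I rule: infinite_finite_induct)
    (simp_all add: zero_witt.rep_eq plus_witt.rep_eq)

lemma single_scaleC: "Poly_Mapping.single m c = c *\<^sub>C Poly_Mapping.single m (1::complex)"
  by (rule poly_mapping_eqI) (auto simp: lookup_single when_def)

lemma single_sum: "Poly_Mapping.single m (sum c I) = (\<Sum>i\<in>I. Poly_Mapping.single m (c i))"
  by (induction I rule: infinite_finite_induct) (simp_all add: single_add)

lemma degree_derivation_single:
  "apply_witt (degree_derivation i) (Poly_Mapping.single m c)
    = Poly_Mapping.single m (of_int (m $ i) * c)"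
  by (rule poly_mapping_eqI)
    (auto simp: degree_derivation.rep_eq lookup_mapp lookup_single when_def in_keys_iff)

lemma witt_monomial_single:
  "apply_witt (witt_monomial u r) (Poly_Mapping.single m c)
    = Poly_Mapping.single (r + m) (pairing u m * c)"
proof -
  have "apply_witt (witt_monomial u r) (Poly_Mapping.single m c)
      = (\<Sum>i\<in>UNIV. u $ i *\<^sub>C Poly_Mapping.single (r + m) (of_int (m $ i) * c))"
    by (simp add: witt_monomial_def apply_witt_sum scaleC_witt.rep_eq apply_laurent_times_witt
        degree_derivation_single mult_single)
  also have "\<dots> = (\<Sum>i\<in>UNIV. Poly_Mapping.single (r + m) (u $ i * of_int (m $ i) * c))"
    by (subst (1 2) single_scaleC) (simp add: scaleC_scaleC mult.assoc)
  also have "\<dots> = Poly_Mapping.single (r + m) (pairing u m * c)"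
    by (simp add: pairing_def sum_distrib_right flip: single_sum)
  finally show ?thesis .
qed

lemma witt_eq_on_monomials:
  assumes "\<And>m. apply_witt D (Poly_Mapping.single m 1) = apply_witt E (Poly_Mapping.single m 1)"
  shows "D = E"
proof (rule witt_eqI)
  fix f
  have "apply_witt D (Poly_Mapping.single m c) = apply_witt E (Poly_Mapping.single m c)" for m c
    unfolding single_scaleC[of m c] by (simp only: apply_witt_rules assms)
  then show "apply_witt D f = apply_witt E f"
    by (subst (1 2) poly_mapping_expand[of f]) (simp add: apply_witt_rules)
qed

lemma pairing_linear: "pairing (u + v) m = pairing u m + pairing v m"
    "pairing (u - v) m = pairing u m - pairing v m" "pairing (a *s u) m = a * pairing u m"
  by (simp_all add: pairing_def sum.distrib sum_subtractf sum_distrib_left algebra_simps)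

lemma witt_monomial_add: "witt_monomial (u + v) r = witt_monomial u r + witt_monomial v r"
  by (rule witt_eq_on_monomials)
    (simp add: plus_witt.rep_eq witt_monomial_single pairing_linear single_add)

lemma witt_monomial_scale: "witt_monomial (a *s u) r = a *\<^sub>C witt_monomial u r"
proof (rule witt_eq_on_monomials)
  fix m
  show "apply_witt (witt_monomial (a *s u) r) (Poly_Mapping.single m 1)
      = apply_witt (a *\<^sub>C witt_monomial u r) (Poly_Mapping.single m 1)"
    by (rule poly_mapping_eqI)
      (auto simp: scaleC_witt.rep_eq witt_monomial_single pairing_linear lookup_single when_def)
qed

lemma witt_monomial_axis_zero: "witt_monomial (axis i 1) 0 = degree_derivation i"
  by (rule witt_eq_on_monomials) (simp add: witt_monomial_single degree_derivation_single)

lemma witt_monomial_bracket: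
  "lie_bracket (witt_monomial u r) (witt_monomial v s)
    = witt_monomial (pairing u s *s v - pairing v r *s u) (r + s)"
  by (rule witt_eq_on_monomials)
    (simp add: lie_bracket_witt.rep_eq witt_monomial_single pairing_linear algebra_simps
      flip: single_diff)

text \<open>The lattice is free on the vectors \<open>axis i 1\<close>.\<close>
lemma additive_on_lattice:
  fixes \<phi> :: "int ^ 'n::finite \<Rightarrow> 'a::complex_vector"
  assumes add: "\<And>m k. \<phi> (m + k) = \<phi> m + \<phi> k"
  shows "\<phi> m = (\<Sum>i\<in>UNIV. of_int (m $ i) *\<^sub>C \<phi> (axis i 1))"
proof -
  have zero: "\<phi> 0 = 0" using add[of 0 0] by simp
  have neg: "\<phi> (- m) = - \<phi> m" for m using add[of m "- m"] zero by (simp add: eq_neg_iff_add_eq_0 add.commute)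
  have nat: "\<phi> (axis i (int n)) = of_nat n *\<^sub>C \<phi> (axis i 1)" for i n
  proof (induction n)
    case 0
    then show ?case by (simp add: zero axis_def zero_vec_def[symmetric])
  next
    case (Suc n)
    have "axis i (int (Suc n)) = axis i (int n) + axis i 1" by (simp add: vec_eq_iff axis_def)
    then show ?case using Suc by (simp add: add scaleC_add_left scaleC_one)
  qed
  have axis: "\<phi> (axis i k) = of_int k *\<^sub>C \<phi> (axis i 1)" for i k
  proof (cases "k \<ge> 0")
    case True
    then show ?thesis using nat[of i "nat k"] by simp
  next
    case False
    have "axis i k = - axis i (- k)" by (simp add: vec_eq_iff axis_def)
    then show ?thesis using nat[of i "nat (- k)"] False by (simp add: neg)
  qed
  have "\<phi> (\<Sum>i\<in>I. axis i (m $ i)) = (\<Sum>i\<in>I. \<phi> (axis i (m $ i)))" for I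
    by (induction I rule: infinite_finite_induct) (simp_all add: zero add)
  moreover have "(\<Sum>i\<in>UNIV. axis i (m $ i)) = m"
    by (simp add: vec_eq_iff axis_def cong: if_cong)
  ultimately have "\<phi> m = (\<Sum>i\<in>UNIV. \<phi> (axis i (m $ i)))" by metis
  also have "\<dots> = (\<Sum>i\<in>UNIV. of_int (m $ i) *\<^sub>C \<phi> (axis i 1))"
    by (intro sum.cong refl axis)
  finally show ?thesis .
qed

text \<open>By the Leibniz rule the logarithmic derivative \<open>\<phi> m = D(t\<^sup>m) t\<^sup>-\<^sup>m\<close> is additive in \<open>m\<close>, so \<open>D\<close> is
  determined by the Laurent polynomials \<open>g i = \<phi> (axis i 1)\<close>, whose terms are the coefficients of the
  monomial derivations.\<close>
lemma witt_sum_of_monomials: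
  fixes D :: "'n::finite witt"
  obtains g :: "'n \<Rightarrow> 'n laurent" where
    "D = (\<Sum>i\<in>UNIV. \<Sum>k\<in>Poly_Mapping.keys (g i). witt_monomial (axis i (Poly_Mapping.lookup (g i) k)) k)"
proof -
  define \<phi> where "\<phi> m = apply_witt D (Poly_Mapping.single m 1) * Poly_Mapping.single (- m) 1" for m
  have inv: "Poly_Mapping.single m 1 * Poly_Mapping.single (- m) 1 = (1 :: 'n laurent)" for m
    by (simp add: mult_single)
  have "\<phi> (m + k) = \<phi> m + \<phi> k" for m k
  proof -
    have 1: "Poly_Mapping.single (m + k) 1 = (Poly_Mapping.single m 1 * Poly_Mapping.single k 1 :: 'n laurent)"
        "Poly_Mapping.single (- (m + k)) 1
          = (Poly_Mapping.single (- m) 1 * Poly_Mapping.single (- k) 1 :: 'n laurent)"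
      by (simp_all add: mult_single)
    have "\<phi> (m + k) = apply_witt D (Poly_Mapping.single m 1) * Poly_Mapping.single (- m) 1
        * (Poly_Mapping.single k 1 * Poly_Mapping.single (- k) 1)
      + apply_witt D (Poly_Mapping.single k 1) * Poly_Mapping.single (- k) 1
        * (Poly_Mapping.single m 1 * Poly_Mapping.single (- m) 1)"
      unfolding \<phi>_def 1 apply_witt_mult by (simp only: algebra_simps)
    then show ?thesis by (simp only: inv) (simp add: \<phi>_def)
  qed
  then have \<phi>: "\<phi> m = (\<Sum>i\<in>UNIV. of_int (m $ i) *\<^sub>C \<phi> (axis i 1))" for m
    by (rule additive_on_lattice)
  define g where "g i = \<phi> (axis i 1)" for i
  have "D = (\<Sum>i\<in>UNIV. \<Sum>k\<in>Poly_Mapping.keys (g i). witt_monomial (axis i (Poly_Mapping.lookup (g i) k)) k)"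
  proof (rule witt_eq_on_monomials)
    fix m
    have summand: "(\<Sum>k\<in>Poly_Mapping.keys (g i). Poly_Mapping.single (k + m) (Poly_Mapping.lookup (g i) k * of_int (m $ i)))
        = of_int (m $ i) *\<^sub>C g i * Poly_Mapping.single m 1" for i
    proof -
      have "of_int (m $ i) *\<^sub>C g i * Poly_Mapping.single m 1
          = of_int (m $ i) *\<^sub>C ((\<Sum>k\<in>Poly_Mapping.keys (g i). Poly_Mapping.single k (Poly_Mapping.lookup (g i) k))
            * Poly_Mapping.single m 1)"
        by (subst (1) poly_mapping_expand[of "g i"]) (simp add: laurent_scaleC_mult)
      also have "\<dots> = (\<Sum>k\<in>Poly_Mapping.keys (g i).
          of_int (m $ i) *\<^sub>C Poly_Mapping.single (k + m) (Poly_Mapping.lookup (g i) k))"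
        by (simp add: sum_distrib_right mult_single complex_vector.scale_sum_right)
      also have "\<dots> = (\<Sum>k\<in>Poly_Mapping.keys (g i).
          Poly_Mapping.single (k + m) (Poly_Mapping.lookup (g i) k * of_int (m $ i)))"
        by (intro sum.cong refl poly_mapping_eqI) (auto simp: lookup_single when_def)
      finally show ?thesis by simp
    qed
    have "apply_witt D (Poly_Mapping.single m 1)
        = apply_witt D (Poly_Mapping.single m 1) * (Poly_Mapping.single m 1 * Poly_Mapping.single (- m) 1)"
      by (simp only: inv) simp
    also have "\<dots> = \<phi> m * Poly_Mapping.single m 1" by (simp add: \<phi>_def mult_ac)
    also have "\<dots> = (\<Sum>i\<in>UNIV. of_int (m $ i) *\<^sub>C g i * Poly_Mapping.single m 1)"
      by (subst \<phi>) (simp add: g_def sum_distrib_right)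
    finally show "apply_witt D (Poly_Mapping.single m 1) = apply_witt (\<Sum>i\<in>UNIV. \<Sum>k\<in>Poly_Mapping.keys (g i).
        witt_monomial (axis i (Poly_Mapping.lookup (g i) k)) k) (Poly_Mapping.single m 1)"
      by (simp add: apply_witt_sum witt_monomial_single summand)
  qed
  then show ?thesis by (rule that)
qed

lemmas SD_simps = zero_witt_laurent_def plus_witt_laurent_def scaleC_witt_laurent_def

text \<open>The monomials span the Lie algebra, so stability of a subspace and the evaluation property, both
  linear in \<open>x\<close>, need to be checked on them only.\<close>
lemma witt_laurent_induct_monomials:
  fixes x :: "'n::finite witt_laurent"
  assumes zero: "P 0" and add: "\<And>x y. P x \<Longrightarrow> P y \<Longrightarrow> P (x + y)" and scale: "\<And>a x. P x \<Longrightarrow> P (a *\<^sub>C x)"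
    and witt: "\<And>u r. P (SD (witt_monomial u r) 0)"
    and laurent: "\<And>m. P (SD 0 (Poly_Mapping.single m 1))"
  shows "P x"
proof -
  have sum: "P (\<Sum>i\<in>I. h i)" if "\<And>i. i \<in> I \<Longrightarrow> P (h i)" for h :: "'i \<Rightarrow> 'n witt_laurent" and I
    using that by (induction I rule: infinite_finite_induct) (auto intro: zero add)
  have SD_add: "SD (E + E') 0 = SD E 0 + SD E' (0 :: 'n laurent)"
      "SD 0 (f + f') = SD 0 f + SD (0 :: 'n witt) f'" "SD 0 0 = (0 :: 'n witt_laurent)" for E E' f f'
    by (simp_all add: SD_simps)
  have SD_left: "SD (\<Sum>i\<in>I. E i) 0 = (\<Sum>i\<in>I. SD (E i) (0 :: 'n laurent))" for E :: "'i \<Rightarrow> 'n witt" and I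
    by (induction I rule: infinite_finite_induct) (simp_all add: SD_add)
  have SD_right: "SD 0 (\<Sum>i\<in>I. f i) = (\<Sum>i\<in>I. SD (0 :: 'n witt) (f i))" for f :: "'i \<Rightarrow> 'n laurent" and I
    by (induction I rule: infinite_finite_induct) (simp_all add: SD_add)
  obtain D f where x: "x = SD D f" by (cases x)
  have "P (SD D 0)"
  proof -
    obtain g :: "'n \<Rightarrow> 'n laurent" where
      "D = (\<Sum>i\<in>UNIV. \<Sum>k\<in>Poly_Mapping.keys (g i). witt_monomial (axis i (Poly_Mapping.lookup (g i) k)) k)"
      by (rule witt_sum_of_monomials)
    then show ?thesis by (simp only: SD_left) (intro sum witt)
  qed
  moreover have "P (SD 0 f)"
  proof -
    have single: "P (SD 0 (Poly_Mapping.single m c))" for m :: "int ^ 'n" and c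
    proof -
      have "SD 0 (Poly_Mapping.single m c) = c *\<^sub>C SD (0 :: 'n witt) (Poly_Mapping.single m 1)"
        by (subst single_scaleC) (simp add: SD_simps)
      then show ?thesis using scale[OF laurent] by simp
    qed
    have "SD 0 f = (\<Sum>k\<in>Poly_Mapping.keys f.
        SD 0 (Poly_Mapping.single k (Poly_Mapping.lookup f k)))"
      by (subst (1) poly_mapping_expand[of f]) (simp only: SD_right)
    then show ?thesis by (simp only:) (intro sum single)
  qed
  ultimately have "P (SD D 0 + SD 0 f)" by (rule add)
  then show ?thesis by (simp add: x SD_simps)
qed

section \<open>From the module to its operators\<close>

definition action :: "('g \<Rightarrow> 'v::complex_vector \<Rightarrow> 'v) \<Rightarrow> 'g \<Rightarrow> 'v endo"
  where "action \<rho> z = Abs_endo (\<rho> z)"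

context
  fixes \<rho> :: "('n::finite witt_laurent, 'b::complex_comm_algebra) tensor \<Rightarrow> 'v::complex_vector \<Rightarrow> 'v"
  assumes module: "lie_module \<rho>"
begin

lemma action_apply: "action \<rho> z \<triangleright> v = \<rho> z v"
  using module by (simp add: action_def lie_module_def cbilinear_def Abs_endo_inverse)

lemma rho_left: "clinear (\<lambda>z. \<rho> z v)"
  using module by (simp add: lie_module_def cbilinear_def)

lemma clinear_action_tens: "clinear (\<lambda>b. action \<rho> (tens x b))"
  by (rule clinearI; rule endo_eqI)
    (simp_all add: action_apply endo_apply_simps tens_add_right tens_scaleC_right
      clinear_rules[OF rho_left])

lemma action_commutator:
  "action \<rho> (tens x b) * action \<rho> (tens y c) - action \<rho> (tens y c) * action \<rho> (tens x b)
    = action \<rho> (tens (lie_bracket x y) (b * c))"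
  using module
  by (intro endo_eqI) (simp add: action_apply endo_apply_simps lie_module_def flip: lie_bracket_tens)

lemma action_zero_left: "action \<rho> (tens 0 b) = 0"
proof -
  have "tens (0 :: 'n witt_laurent) b = 0"
    using clinear_rules(4)[OF cbilinearD(2)[OF cbilinear_tens, of b]] .
  then show ?thesis
    by (intro endo_eqI) (simp add: action_apply endo_apply_simps clinear_rules[OF rho_left])
qed

lemma action_scale_left: "action \<rho> (tens (a *\<^sub>C x) b) = a *\<^sub>C action \<rho> (tens x b)"
  by (intro endo_eqI)
    (simp add: action_apply endo_apply_simps tens_scaleC_left clinear_rules[OF rho_left])

lemma action_add_left: "action \<rho> (tens (x + y) b) = action \<rho> (tens x b) + action \<rho> (tens y b)"
  by (intro endo_eqI)
    (simp add: action_apply endo_apply_simps tens_add_left clinear_rules[OF rho_left])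

lemma weight_vector_exists:
  assumes "direct_sum_of U" "(UNIV :: 'w::complex_vector set) \<noteq> {0}"
  shows "\<exists>i. \<exists>v\<in>U i. v \<noteq> (0 :: 'w)"
proof (rule ccontr)
  assume none: "\<not> ?thesis"
  obtain v :: 'w where v: "v \<noteq> 0" using assms(2) by blast
  obtain f where f: "\<forall>i. Poly_Mapping.lookup f i \<in> U i"
      "v = (\<Sum>i\<in>Poly_Mapping.keys f. Poly_Mapping.lookup f i)"
    using assms(1) unfolding direct_sum_of_def by (metis (no_types, lifting))
  have "Poly_Mapping.lookup f i = 0" for i using f(1) none by blast
  then show False using f(2) v by simp
qed

lemma weight_spaces_bounded:
  assumes "uniformly_bounded \<rho>"
  shows "\<exists>N. \<forall>\<mu>. \<exists>S. finite S \<and> card S \<le> N \<and> weight_space \<rho> \<mu> \<subseteq> cspan S"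
proof -
  obtain N where "\<forall>\<mu>. weight_space \<rho> \<mu> \<noteq> {0} \<longrightarrow>
      finite_dimensional (weight_space \<rho> \<mu>) \<and> cdim (weight_space \<rho> \<mu>) < N"
    using assms by (auto simp: uniformly_bounded_def)
  then have N: "finite_dimensional (weight_space \<rho> \<mu>)" "cdim (weight_space \<rho> \<mu>) < N"
    if "weight_space \<rho> \<mu> \<noteq> {0}" for \<mu>
    using that by simp_all
  have "\<exists>S. finite S \<and> card S \<le> N \<and> weight_space \<rho> \<mu> \<subseteq> cspan S" for \<mu>
  proof (cases "weight_space \<rho> \<mu> = {0}")
    case True
    then show ?thesis by (intro exI[of _ "{}"]) simp
  next
    case False
    obtain B where B: "B \<subseteq> weight_space \<rho> \<mu>" "complex_vector.independent B"
        "weight_space \<rho> \<mu> \<subseteq> cspan B" "card B = cdim (weight_space \<rho> \<mu>)"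
      by (rule complex_vector.basis_exists)
    obtain S where "finite S" "weight_space \<rho> \<mu> \<subseteq> cspan S"
      using N(1)[OF False] by (auto simp: finite_dimensional_def)
    then have "finite B"
      using complex_vector.independent_span_bound[of S B] B by blast
    then show ?thesis using B N(2)[OF False] by (intro exI[of _ B]) auto
  qed
  then show ?thesis by blast
qed

lemma bounded_current_module_action:
  assumes irr: "irreducible_module \<rho>" and bounded: "uniformly_bounded \<rho>"
    and unit: "\<And>v. \<rho> (tens (SD 0 (Poly_Mapping.single 0 1)) 1) v = v"
  shows "bounded_current_module (\<lambda>m b. action \<rho> (tens (SD 0 (Poly_Mapping.single m 1)) b))
    (\<lambda>u r b. action \<rho> (tens (SD (witt_monomial u r) 0) b)) (weight_space \<rho>)"
    (is "bounded_current_module ?T ?D _")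
proof (rule bounded_current_module.intro)
  show "clinear (?T m)" "clinear (?D u r)" for m u r by (rule clinear_action_tens)+
  show "?D (u + v) r b = ?D u r b + ?D v r b" for u v r b
  proof -
    have "SD (witt_monomial (u + v) r) 0 = SD (witt_monomial u r) 0 + SD (witt_monomial v r) (0 :: 'n laurent)"
      by (simp add: witt_monomial_add SD_simps)
    then show ?thesis by (simp add: action_add_left)
  qed
  show "?D (a *s u) r b = a *\<^sub>C ?D u r b" for a u r b
  proof -
    have "SD (witt_monomial (a *s u) r) 0 = a *\<^sub>C SD (witt_monomial u r) (0 :: 'n laurent)"
      by (simp add: witt_monomial_scale SD_simps)
    then show ?thesis by (simp add: action_scale_left)
  qed
  show "?T m b * ?T k c = ?T k c * ?T m b" for m b k c
  proof -
    have "lie_bracket (SD 0 (Poly_Mapping.single m 1)) (SD 0 (Poly_Mapping.single k 1)) = (0 :: 'n witt_laurent)"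
      by (simp add: lie_bracket_witt_laurent_def zero_witt_laurent_def zero_witt.rep_eq lie_self)
    then show ?thesis
      using action_commutator[of "SD 0 (Poly_Mapping.single m 1)" b "SD 0 (Poly_Mapping.single k 1)" c]
      by (simp add: action_zero_left)
  qed
  show "?D u r b * ?T m c - ?T m c * ?D u r b = pairing u m *\<^sub>C ?T (r + m) (b * c)" for u r b m c
  proof -
    have "lie_bracket (witt_monomial u r) 0 = 0"
      by (rule witt_eqI) (simp add: lie_bracket_witt.rep_eq zero_witt.rep_eq apply_witt_rules)
    then have "lie_bracket (SD (witt_monomial u r) 0) (SD 0 (Poly_Mapping.single m 1))
        = pairing u m *\<^sub>C SD 0 (Poly_Mapping.single (r + m) 1)"
      using single_scaleC[of "r + m" "pairing u m"]
      by (simp add: lie_bracket_witt_laurent_def SD_simps witt_monomial_single zero_witt.rep_eq)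
    then show ?thesis by (simp add: action_commutator action_scale_left)
  qed
  show "?D u r b * ?D v s c - ?D v s c * ?D u r b
      = ?D (pairing u s *s v - pairing v r *s u) (r + s) (b * c)" for u r b v s c
    unfolding action_commutator
    by (simp add: lie_bracket_witt_laurent_def witt_monomial_bracket apply_witt_rules)
  show "?T 0 1 = 1"
    by (rule endo_eqI) (simp only: action_apply one_endo.rep_eq unit)
  show "U = {0} \<or> U = UNIV"
    if U: "csubspace U" "\<And>m b v. v \<in> U \<Longrightarrow> ?T m b \<triangleright> v \<in> U"
      "\<And>u r b v. v \<in> U \<Longrightarrow> ?D u r b \<triangleright> v \<in> U" for U
  proof -
    note closed = complex_vector.subspace_0[OF U(1)] complex_vector.subspace_add[OF U(1)]
      complex_vector.subspace_scale[OF U(1)]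
    have tens: "\<forall>b. \<forall>v\<in>U. action \<rho> (tens x b) \<triangleright> v \<in> U" for x
      by (induction x rule: witt_laurent_induct_monomials)
        (use U(2,3) closed in \<open>auto simp: action_zero_left action_add_left action_scale_left endo_apply_simps\<close>)
    have "\<forall>v\<in>U. \<rho> z v \<in> U" for z
      by (induction z rule: tensor_induct)
        (use tens closed in \<open>auto simp: action_apply clinear_rules[OF rho_left]\<close>)
    then show ?thesis using irr U(1) by (auto simp: irreducible_module_def submodule_def)
  qed
  show "weight_space \<rho> \<mu> = {v. \<forall>i. ?D (axis i 1) 0 1 \<triangleright> v = (\<mu> $ i) *\<^sub>C v}" for \<mu>
    by (simp add: weight_space_def action_apply witt_monomial_axis_zero)
  show "\<exists>\<mu>. \<exists>v\<in>weight_space \<rho> \<mu>. v \<noteq> 0"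
    using weight_vector_exists bounded irr by (auto simp: uniformly_bounded_def irreducible_module_def)
  show "\<exists>N. \<forall>\<mu>. \<exists>S. finite S \<and> card S \<le> N \<and> weight_space \<rho> \<mu> \<subseteq> cspan S"
    by (rule weight_spaces_bounded[OF bounded])
qed

end

theorem theorem3p12:
  fixes \<rho> :: "('n::finite witt_laurent, 'b::complex_comm_algebra) tensor \<Rightarrow> 'v::complex_vector \<Rightarrow> 'v"
  assumes "finitely_generated_algebra TYPE('b)"
    and "lie_module \<rho>"
    and "irreducible_module \<rho>"
    and "uniformly_bounded \<rho>"
    and "\<And>v. \<rho> (tens (SD 0 (Poly_Mapping.single 0 1)) 1) v = v"
  shows "single_point_evaluation \<rho>"
proof -
  note module = assms(2)
  interpret bounded_current_module
    "\<lambda>m b. action \<rho> (tens (SD 0 (Poly_Mapping.single m 1)) b)"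
    "\<lambda>u r b. action \<rho> (tens (SD (witt_monomial u r) 0) b)" "weight_space \<rho>"
    by (rule bounded_current_module_action[OF assms(2-)])
  obtain \<eta> where \<eta>: "algebra_hom \<eta>"
      "\<And>m b. action \<rho> (tens (SD 0 (Poly_Mapping.single m 1)) b)
        = \<eta> b *\<^sub>C action \<rho> (tens (SD 0 (Poly_Mapping.single m 1)) 1)"
      "\<And>u r b. action \<rho> (tens (SD (witt_monomial u r) 0) b)
        = \<eta> b *\<^sub>C action \<rho> (tens (SD (witt_monomial u r) 0) 1)"
    using single_point by blast
  have "action \<rho> (tens x b) = \<eta> b *\<^sub>C action \<rho> (tens x 1)" for x b
    by (induction x rule: witt_laurent_induct_monomials)
      (simp_all add: action_zero_left[OF module] action_add_left[OF module]
        action_scale_left[OF module] scaleC_add_right scaleC_scaleC mult.commute \<eta>(2,3)[symmetric])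
  then have "action \<rho> (tens x b) \<triangleright> v = (\<eta> b *\<^sub>C action \<rho> (tens x 1)) \<triangleright> v" for x b v
    by (rule arg_cong)
  then have "\<rho> (tens x b) v = \<eta> b *\<^sub>C \<rho> (tens x 1) v" for x b v
    unfolding scaleC_endo.rep_eq action_apply[OF module] .
  then show ?thesis using \<eta>(1) unfolding single_point_evaluation_def by blast
qed

end
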